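(* Let $\mathfrak{q}\in\mathbb{R}$ and $v,v'\in\mathbb{R}$. For the dilaton (and tensor) mode, the retarded bulk Green's function of the linear dilaton black hole is $$G(\mathfrak{w},\mathfrak{q};v,v')=i\,\frac{(u_<u_>)^{(c-1)/2}\,[(1-u_<)(1-u_>)]^{-i\mathfrak{w}/2}}{(1-c)\,C_{01}}\;{}_2F_1(a,b;c;u_<)\;{}_2F_1(a,b;1-c+a+b;1-u_>),$$ where $c=1+\sqrt{1+\mathfrak{q}^2-\mathfrak{w}^2}$, $a=b=\frac{c-i\mathfrak{w}}{2}$, $C_{01}=\frac{\Gamma(1-c+a+b)\Gamma(c-1)}{\Gamma(a)\Gamma(b)}$, and the Wronskian satisfies $$iW(\mathfrak{w},\mathfrak{q})=(1-c)\,C_{01}=-\frac{\Gamma(1-c+a+b)\Gamma(c)}{\Gamma(a)\Gamma(b)} .$$ Moreover, as a function of $\mathfrak{w}$, $G$ has no singularities (is holomorphic) in the open upper half plane $\operatorname{Im}\mathfrak{w}>0$ of the physical sheet, where $\operatorname{Re}\sqrt{1+\mathfrak{q}^2-\mathfrak{w}^2}>0$.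
   Context: Let $u=u(v)\in(0,1)$ be determined by $v=\log u-\log(1-u)$, so $v\to-\infty$ is spatial infinity and $v\to+\infty$ is the horizon. The mode satisfies the Schrödinger equation $$\big(-\partial_v^2+V(v)\big)\psi=\frac{\mathfrak{w}^2}{4}\psi,\qquad V(v)=\frac{1-u(v)^2+\mathfrak{q}^2(1-u(v))}{4}.$$ Let $\psi_<$ be the solution with $\psi_<\sim e^{\sqrt{1+\mathfrak{q}^2-\mathfrak{w}^2}\,v/2}$ as $v\to-\infty$ and $\psi_>$ the solution with $\psi_>\sim e^{i\mathfrak{w}v/2}$ as $v\to+\infty$; explicitly $\psi_<=u^{(c-1)/2}(1-u)^{-i\mathfrak{w}/2}{}_2F_1(a,b;c;u)$ and $\psi_>=u^{(c-1)/2}(1-u)^{-i\mathfrak{w}/2}{}_2F_1(a,b;1-c+a+b;1-u)$. The Green's function is defined by $$G(\mathfrak{w},\mathfrak{q};v,v')=\frac{\psi_<(v_<)\,\psi_>(v_>)}{W},\qquad iW=\psi_<\,\partial_v\psi_>-(\partial_v\psi_<)\,\psi_>,$$ with $v_<=\min(v,v')$, $v_>=\max(v,v')$, $u_<=u(v_<)$, $u_>=u(v_>)$. *)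

theory Defs
  imports "HOL-Complex_Analysis.Complex_Analysis" "HOL-Library.Landau_Symbols"
begin

definition u_of :: "real \<Rightarrow> real" where
  "u_of v = (THE u. 0 < u \<and> u < 1 \<and> v = ln u - ln (1 - u))"

definition potential :: "real \<Rightarrow> real \<Rightarrow> real" where
  "potential q v = (1 - (u_of v)\<^sup>2 + q\<^sup>2 * (1 - u_of v)) / 4"

definition mode_solution :: "real \<Rightarrow> complex \<Rightarrow> (real \<Rightarrow> complex) \<Rightarrow> bool" where
  "mode_solution q w \<psi> \<longleftrightarrow>
     (\<exists>\<psi>1 \<psi>2. \<forall>v. (\<psi> has_vector_derivative \<psi>1 v) (at v) \<and>
                 (\<psi>1 has_vector_derivative \<psi>2 v) (at v) \<and>
                 - \<psi>2 v + of_real (potential q v) * \<psi> v = w\<^sup>2 / 4 * \<psi> v)"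

definition hyp2F1 :: "complex \<Rightarrow> complex \<Rightarrow> complex \<Rightarrow> complex \<Rightarrow> complex" where
  "hyp2F1 a b c z = eval_fps (fps_hypergeo [a, b] [c] 1) z"

(* Below, the parameters are the frequency w and c = 1 + s, where s is a square root
   of 1 + q^2 - w^2. Keeping c separate from w allows both sheets of the square root;
   q enters only through c. The hypergeometric parameters satisfy a = b. *)

definition hyp_a :: "complex \<Rightarrow> complex \<Rightarrow> complex" where
  "hyp_a w c = (c - \<i> * w) / 2"

definition psi_less :: "complex \<Rightarrow> complex \<Rightarrow> real \<Rightarrow> complex" where
  "psi_less w c v =
     (let u = u_of v; a = hyp_a w c; b = a in
        of_real u powr ((c - 1) / 2) * of_real (1 - u) powr (- \<i> * w / 2) *
        hyp2F1 a b c (of_real u))"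

definition psi_greater :: "complex \<Rightarrow> complex \<Rightarrow> real \<Rightarrow> complex" where
  "psi_greater w c v =
     (let u = u_of v; a = hyp_a w c; b = a in
        of_real u powr ((c - 1) / 2) * of_real (1 - u) powr (- \<i> * w / 2) *
        hyp2F1 a b (1 - c + a + b) (of_real (1 - u)))"

definition wronskian_at :: "(real \<Rightarrow> complex) \<Rightarrow> (real \<Rightarrow> complex) \<Rightarrow> real \<Rightarrow> complex" where
  "wronskian_at f g v = f v * vector_derivative g (at v) - vector_derivative f (at v) * g v"

(* The constant W with i W = f g' - f' g. *)
definition W_const :: "complex \<Rightarrow> complex \<Rightarrow> complex" where
  "W_const w c = (THE W. \<forall>v. \<i> * W = wronskian_at (psi_less w c) (psi_greater w c) v)"

definition greens :: "complex \<Rightarrow> complex \<Rightarrow> real \<Rightarrow> real \<Rightarrow> complex" where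
  "greens w c v v' = psi_less w c (min v v') * psi_greater w c (max v v') / W_const w c"

(* Gamma and division are total: at a pole of Gamma a (a zero of W) the value is 0,
   in agreement with the entire function 1 / Gamma. *)
definition C01 :: "complex \<Rightarrow> complex \<Rightarrow> complex" where
  "C01 w c = (let a = hyp_a w c; b = a in
     Gamma (1 - c + a + b) * Gamma (c - 1) / (Gamma a * Gamma b))"

(* csqrt has nonnegative real part, so this is c on the physical sheet. *)
definition c_phys :: "real \<Rightarrow> complex \<Rightarrow> complex" where
  "c_phys q w = 1 + csqrt (1 + (of_real q)\<^sup>2 - w\<^sup>2)"

end

(* With al = s/2 and be = -i w/2 the equation is f'' = (al^2 (1-u) + be^2 u + u(1-u)/4) f, which is
   invariant under v -> -v together with al <-> be. Hence psi_> is the reflection of the same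
   hypergeometric solution as psi_<, and every statement is needed only at v -> -infinity.

   Uniqueness: if f and p have the same asymptotics, then (f/p)' = C/p^2 with C the Wronskian. As
   f/p converges while 1/p^2 does not tend to 0, C = 0; so f = p near -infinity, hence everywhere.

   Wronskian: it is constant in v, so for Re (1 + 2 be) > 0 it can be read off from u -> 1. There F'(u)
   is compared, coefficient by coefficient, with the binomial series of (1-u)^(-(1+2 be)); the ratio of
   the coefficients converges by Euler's product for 1/Gamma. This covers a half-plane of be; the
   rest follows by analytic continuation in be at a fixed u.

   Holomorphy: for Im w > 0 and Re s > 0 the arguments of all Gamma functions in W have positive real
   part, so W has no zeros. *)

theory Submission
  imports Defs "HOL-Real_Asymp.Real_Asymp"
begin

section \<open>The hypergeometric series\<close>

text \<open>The Wronskian is a coefficient of Gauss's connection formula, but that formula is not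
  derived. Constancy in v replaces it: one limit at u -> 1 fixes the value, and it is accessible as
  long as the singular part of F' dominates.

  The relation s^2 = 1 + q^2 - w^2 ties the square root to the frequency, so continuing in w would
  drag s through its branch points. Therefore al and be are independent parameters throughout the
  computation of the Wronskian: al stays fixed while be ranges over the plane without a countable
  set of poles, which is connected.

  What survives is a lower bound for |1/p^2|. As 1/p^2 may oscillate, its integral over a long
  interval can cancel; over a short interval of fixed length it cannot.\<close>

definition hyp_coeff :: "complex \<Rightarrow> complex \<Rightarrow> complex \<Rightarrow> nat \<Rightarrow> complex" where
  "hyp_coeff a b c n = pochhammer a n * pochhammer b n / (pochhammer c n * fact n)"

lemma fps_nth_hypergeo: "fps_nth (fps_hypergeo [a, b] [c] 1) n = hyp_coeff a b c n"
  by (simp add: hyp_coeff_def)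

text \<open>The recurrence survives c + n = 0, where division by zero makes both sides 0. This is
  why convergence of the series is available for every c.\<close>

lemma hyp_coeff_Suc:
  "hyp_coeff a b c (Suc n) =
     hyp_coeff a b c n * ((a + of_nat n) * (b + of_nat n) / ((c + of_nat n) * of_nat (Suc n)))"
  by (simp add: hyp_coeff_def pochhammer_Suc mult_ac)

lemma hyp2F1_eq_suminf: "hyp2F1 a b c z = (\<Sum>n. hyp_coeff a b c n * z ^ n)"
  by (simp add: hyp2F1_def eval_fps_def fps_nth_hypergeo del: fps_hypergeo_nth)

lemma nonpos_Ints_add_of_nat_neq_0:
  fixes c :: complex
  assumes "c \<notin> \<int>\<^sub>\<le>\<^sub>0"
  shows "c + of_nat n \<noteq> 0"
  using assms by (metis add_eq_0_iff2 minus_of_nat_in_nonpos_Ints)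

text \<open>A ratio test whose N and \<rho> depend only on r and the bound A on the parameters. For
  n > A, the number c + n stays at distance at least n - A from 0, so one majorant of the quotients
  serves all parameters at once. This uniformity is what holomorphy in the parameters
  requires.\<close>

lemma hyp_coeff_ratio_uniform:
  fixes r A :: real
  assumes r: "0 \<le> r" "r < 1" and A: "0 \<le> A"
  obtains N \<rho> where "0 \<le> \<rho>" "\<rho> < 1"
    "\<And>a b c n. n \<ge> N \<Longrightarrow> norm a \<le> A \<Longrightarrow> norm b \<le> A \<Longrightarrow> norm c \<le> A \<Longrightarrow>
       norm (hyp_coeff a b c (Suc n)) * r ^ Suc n \<le> \<rho> * (norm (hyp_coeff a b c n) * r ^ n)"
proof -
  define \<rho> where "\<rho> = (r + 1) / 2"
  have \<rho>: "r < \<rho>" "\<rho> < 1" "0 \<le> \<rho>" using r by (auto simp: \<rho>_def)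
  have "((\<lambda>n. (A + real n) * (A + real n) / ((real n - A) * (real n + 1)) * r) \<longlongrightarrow> 1 * r) sequentially"
    by (rule tendsto_mult[OF _ tendsto_const]) real_asymp
  then have "eventually (\<lambda>n. (A + real n) * (A + real n) / ((real n - A) * (real n + 1)) * r < \<rho>) sequentially"
    using \<rho> by (intro order_tendstoD) auto
  moreover have "eventually (\<lambda>n. real n > A) sequentially"
    by real_asymp
  ultimately obtain N where N: "\<And>n. n \<ge> N \<Longrightarrow>
      (A + real n) * (A + real n) / ((real n - A) * (real n + 1)) * r < \<rho> \<and> real n > A"
    by (metis (no_types, lifting) eventually_conj eventually_sequentially)
  show ?thesis
  proof (rule that[OF \<rho>(3,2)])
    fix a b c :: complex and n
    assume n: "n \<ge> N" and abc: "norm a \<le> A" "norm b \<le> A" "norm c \<le> A"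
    have na: "norm (a + of_nat n) \<le> A + real n" and nb: "norm (b + of_nat n) \<le> A + real n"
      using norm_triangle_ineq[of a "of_nat n"] norm_triangle_ineq[of b "of_nat n"] abc by auto
    have nc: "real n - A \<le> norm (c + of_nat n)"
      using norm_diff_ineq[of "of_nat n" c] abc by (simp add: add.commute)
    have pos: "real n - A > 0" using N[OF n] by simp
    have eq: "norm ((a + of_nat n) * (b + of_nat n) / ((c + of_nat n) * of_nat (Suc n)))
        = norm (a + of_nat n) * norm (b + of_nat n) / (norm (c + of_nat n) * (real n + 1))"
      by (simp only: norm_divide norm_mult norm_of_nat) simp
    have "norm ((a + of_nat n) * (b + of_nat n) / ((c + of_nat n) * of_nat (Suc n))) * r
        \<le> (A + real n) * (A + real n) / ((real n - A) * (real n + 1)) * r"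
      unfolding eq using na nb nc pos r A
      by (intro mult_right_mono frac_le mult_mono mult_nonneg_nonneg mult_pos_pos) auto
    also have "\<dots> \<le> \<rho>" using N[OF n] by simp
    finally have q: "norm ((a + of_nat n) * (b + of_nat n) / ((c + of_nat n) * of_nat (Suc n))) * r \<le> \<rho>" .
    have "norm (hyp_coeff a b c (Suc n)) * r ^ Suc n =
        (norm ((a + of_nat n) * (b + of_nat n) / ((c + of_nat n) * of_nat (Suc n))) * r) *
        (norm (hyp_coeff a b c n) * r ^ n)"
      unfolding hyp_coeff_Suc norm_mult[of "hyp_coeff a b c n"] power_Suc by (simp only: mult_ac)
    also have "\<dots> \<le> \<rho> * (norm (hyp_coeff a b c n) * r ^ n)"
      using q r by (intro mult_right_mono) auto
    finally show "norm (hyp_coeff a b c (Suc n)) * r ^ Suc n \<le> \<rho> * (norm (hyp_coeff a b c n) * r ^ n)" .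
  qed
qed

lemma summable_hyp_term:
  assumes z: "norm z < 1"
  shows "summable (\<lambda>n. hyp_coeff a b c n * z ^ n)"
proof -
  define A where "A = max (norm a) (max (norm b) (norm c))"
  have "0 \<le> A" by (simp add: A_def le_max_iff_disj)
  then obtain N \<rho> where
    \<rho>: "0 \<le> \<rho>" "\<rho> < 1" and *: "\<And>a b c n. n \<ge> N \<Longrightarrow> norm a \<le> A \<Longrightarrow> norm b \<le> A \<Longrightarrow> norm c \<le> A \<Longrightarrow>
       norm (hyp_coeff a b c (Suc n)) * norm z ^ Suc n \<le> \<rho> * (norm (hyp_coeff a b c n) * norm z ^ n)"
    by (rule hyp_coeff_ratio_uniform[OF norm_ge_zero z]) (rule that; assumption)
  show ?thesis
  proof (rule summable_ratio_test[OF \<rho>(2), of N])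
    show "norm (hyp_coeff a b c (Suc n) * z ^ Suc n) \<le> \<rho> * norm (hyp_coeff a b c n * z ^ n)"
      if "N \<le> n" for n
      using *[OF that, of a b c] by (simp add: norm_mult norm_power A_def)
  qed
qed

lemma fps_conv_radius_hypergeo: "fps_conv_radius (fps_hypergeo [a, b] [c] (1::complex)) \<ge> 1"
  unfolding fps_conv_radius_def
proof (rule conv_radius_geI_ex')
  fix r :: real assume "0 < r" "ereal r < 1"
  then show "summable (\<lambda>n. fps_nth (fps_hypergeo [a, b] [c] 1) n * of_real r ^ n)"
    unfolding fps_nth_hypergeo by (intro summable_hyp_term) auto
qed

lemma norm_less_conv_radius_hypergeo:
  "norm z < 1 \<Longrightarrow> ereal (norm (z::complex)) < fps_conv_radius (fps_hypergeo [a, b] [c] (1::complex))"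
  using fps_conv_radius_hypergeo[of a b c] by (metis ereal_less(3) less_le_trans)

lemma hyp2F1_0 [simp]: "hyp2F1 a b c 0 = 1"
  by (simp add: hyp2F1_def eval_fps_at_0 fps_nth_hypergeo del: fps_hypergeo_nth)

lemma fps_deriv_hypergeo:
  fixes a b c :: complex
  assumes c: "c \<notin> \<int>\<^sub>\<le>\<^sub>0"
  shows "fps_deriv (fps_hypergeo [a, b] [c] 1) =
    fps_const (a * b / c) * fps_hypergeo [a + 1, b + 1] [c + 1] 1"
proof (rule fps_ext)
  fix n
  show "fps_nth (fps_deriv (fps_hypergeo [a, b] [c] 1)) n =
    fps_nth (fps_const (a * b / c) * fps_hypergeo [a + 1, b + 1] [c + 1] 1) n"
    unfolding fps_deriv_nth fps_mult_left_const_nth fps_nth_hypergeo hyp_coeff_def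
    by (simp add: pochhammer_rec add.commute del: of_nat_Suc)
qed

lemma has_field_derivative_hyp2F1:
  assumes c: "c \<notin> \<int>\<^sub>\<le>\<^sub>0" and z: "norm z < 1"
  shows "(hyp2F1 a b c has_field_derivative a * b / c * hyp2F1 (a + 1) (b + 1) (c + 1) z) (at z within S)"
proof -
  have "eval_fps (fps_const (a * b / c) * fps_hypergeo [a + 1, b + 1] [c + 1] 1) z =
      a * b / c * hyp2F1 (a + 1) (b + 1) (c + 1) z"
    using z by (subst eval_fps_mult) (auto simp: hyp2F1_def norm_less_conv_radius_hypergeo)
  then show ?thesis
    using has_field_derivative_eval_fps[OF norm_less_conv_radius_hypergeo[OF z], of a b c S]
    by (simp add: fps_deriv_hypergeo[OF c] hyp2F1_def[abs_def])
qed

lemma continuous_on_hyp2F1: "continuous_on (ball 0 1) (hyp2F1 a b c)"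
  unfolding hyp2F1_def[abs_def]
  using continuous_on_subset[OF continuous_on_eval_fps] norm_less_conv_radius_hypergeo
  by (metis (no_types, lifting) in_eball_iff dist_0_norm mem_ball subsetI)

text \<open>The two shifted functions are F'' and F' with their factors. As an identity of formal
  power series the equation is just the recurrence (c + n) (n + 1) h(n + 1) = (a + n) (b + n) h(n),
  and it is then evaluated at z.\<close>

lemma hypergeometric_equation:
  assumes c: "c \<notin> \<int>\<^sub>\<le>\<^sub>0" and z: "norm z < 1"
  shows "z * (1 - z) * (a * b / c * ((a + 1) * (b + 1) / (c + 1) * hyp2F1 (a + 2) (b + 2) (c + 2) z))
    + (c - (a + b + 1) * z) * (a * b / c * hyp2F1 (a + 1) (b + 1) (c + 1) z)
    - a * b * hyp2F1 a b c z = 0"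
proof -
  let ?H = "fps_hypergeo [a, b] [c] 1 :: complex fps"
  let ?H1 = "fps_hypergeo [a + 1, b + 1] [c + 1] 1 :: complex fps"
  let ?H2 = "fps_hypergeo [a + 2, b + 2] [c + 2] 1 :: complex fps"
  have c1: "c + 1 \<notin> \<int>\<^sub>\<le>\<^sub>0"
    using plus_one_in_nonpos_Ints_imp c by blast
  have d1: "fps_deriv ?H = fps_const (a * b / c) * ?H1"
    by (rule fps_deriv_hypergeo[OF c])
  have d2: "fps_deriv (fps_deriv ?H) = fps_const (a * b / c) * (fps_const ((a + 1) * (b + 1) / (c + 1)) * ?H2)"
    unfolding d1 using fps_deriv_hypergeo[OF c1, of "a + 1" "b + 1"] by (simp add: add.assoc)
  have cancel: "D * (h * (P / D)) = P * h" if "D \<noteq> 0" for D h P :: complex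
    using that by simp
  have rec: "(c + of_nat n) * of_nat (Suc n) * fps_nth ?H (Suc n) = (a + of_nat n) * (b + of_nat n) * fps_nth ?H n" for n
    unfolding fps_nth_hypergeo hyp_coeff_Suc
    using cancel[of "(c + of_nat n) * of_nat (Suc n)" "hyp_coeff a b c n"] nonpos_Ints_add_of_nat_neq_0[OF c, of n]
    by (simp del: of_nat_Suc)
  define h where "h = fps_nth ?H"
  note rec = rec[folded h_def]
  have "fps_X * fps_deriv (fps_deriv ?H) - fps_X * (fps_X * fps_deriv (fps_deriv ?H))
     + fps_const c * fps_deriv ?H - fps_const (a + b + 1) * (fps_X * fps_deriv ?H) - fps_const (a * b) * ?H = 0"
    (is "?L = 0")
  proof (rule fps_ext)
    fix n
    show "fps_nth ?L n = fps_nth 0 n"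
    proof (cases n)
      case 0
      then show ?thesis using rec[of 0]
        by (simp add: fps_X_mult_nth h_def[symmetric] del: fps_hypergeo_nth)
    next
      case (Suc m)
      have "fps_nth (fps_X * fps_deriv (fps_deriv ?H)) m = of_nat m * of_nat (Suc m) * h (Suc m)"
        by (cases m) (simp_all add: fps_X_mult_nth mult_ac h_def[symmetric] del: fps_hypergeo_nth)
      with Suc rec[of "Suc m"] show ?thesis
        by (simp add: fps_X_mult_nth h_def[symmetric] del: fps_hypergeo_nth) (simp add: algebra_simps)
    qed
  qed
  then have e0: "eval_fps ?L z = 0" by simp
  \<comment> \<open>Evaluation respects sums and products only inside the disc of convergence.
    \<open>conv\<close> carries this side condition through the simplifier.\<close>
  define conv where "conv f \<longleftrightarrow> ereal (norm z) < fps_conv_radius f" for f :: "complex fps"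
  have e1: "eval_fps ?L z = z * (a * b / c * ((a + 1) * (b + 1) / (c + 1) * hyp2F1 (a + 2) (b + 2) (c + 2) z))
      - z * (z * (a * b / c * ((a + 1) * (b + 1) / (c + 1) * hyp2F1 (a + 2) (b + 2) (c + 2) z)))
      + c * (a * b / c * hyp2F1 (a + 1) (b + 1) (c + 1) z)
      - (a + b + 1) * (z * (a * b / c * hyp2F1 (a + 1) (b + 1) (c + 1) z)) - a * b * hyp2F1 a b c z"
  proof -
    have eval [simp]: "eval_fps (f + g) z = eval_fps f z + eval_fps g z"
        "eval_fps (f - g) z = eval_fps f z - eval_fps g z"
        "eval_fps (f * g) z = eval_fps f z * eval_fps g z"
        "conv (f + g)" "conv (f - g)" "conv (f * g)"
      if "conv f" "conv g" for f g
      using that fps_conv_radius_add[of f g] fps_conv_radius_diff[of f g] fps_conv_radius_mult[of f g]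
      by (auto simp: conv_def eval_fps_add eval_fps_diff eval_fps_mult min_def split: if_splits)
    have conv [simp]: "conv ?H" "conv ?H1" "conv ?H2" "conv fps_X" "\<And>x. conv (fps_const x)"
      using z by (auto simp: conv_def norm_less_conv_radius_hypergeo)
    show ?thesis
      unfolding d2 unfolding d1
      by (simp add: hyp2F1_def)
  qed
  have e2: "z * A - z * (z * A) + c * B - (a + b + 1) * (z * B) - a * b * F =
      z * (1 - z) * A + (c - (a + b + 1) * z) * B - a * b * F" for A B F
    by (simp add: algebra_simps)
  show ?thesis using e1[unfolded e0 e2] by (rule sym)
qed

section \<open>Dependence on the parameters and behaviour at 1\<close>

text \<open>Here z is fixed and the parameters vary. The partial sums are holomorphic because c
  avoids its poles, and the uniform ratio bound makes them converge uniformly on small closed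
  discs.\<close>

lemma holomorphic_hyp2F1:
  assumes S: "open S" and a: "a holomorphic_on S" and b: "b holomorphic_on S" and c: "c holomorphic_on S"
    and c_nonpole: "\<And>x. x \<in> S \<Longrightarrow> c x \<notin> \<int>\<^sub>\<le>\<^sub>0" and z: "norm z < 1"
  shows "(\<lambda>x. hyp2F1 (a x) (b x) (c x) z) holomorphic_on S"
proof (rule holomorphic_uniform_sequence[OF S])
  have hol: "(\<lambda>x. hyp_coeff (a x) (b x) (c x) n) holomorphic_on S" for n
  proof -
    have "pochhammer (c x) n \<noteq> 0" if "x \<in> S" for x
      using c_nonpole[OF that] by (auto simp: pochhammer_eq_0_iff)
    then show ?thesis
      unfolding hyp_coeff_def using a b c by (intro holomorphic_intros) auto
  qed
  then show "(\<lambda>x. \<Sum>i<n. hyp_coeff (a x) (b x) (c x) i * z ^ i) holomorphic_on S" for n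
    by (intro holomorphic_intros)
  fix x assume x: "x \<in> S"
  then obtain d where d: "d > 0" "cball x d \<subseteq> S"
    using S open_contains_cball by blast
  have bdd: "\<exists>A. \<forall>y\<in>cball x d. norm (f y) \<le> A" if "f holomorphic_on S" for f :: "complex \<Rightarrow> complex"
    using compact_imp_bounded[OF compact_continuous_image[OF holomorphic_on_imp_continuous_on[OF holomorphic_on_subset[OF that d(2)]]]]
    by (auto simp: bounded_iff)
  obtain Aa Ab Ac where A: "\<And>y. y \<in> cball x d \<Longrightarrow> norm (a y) \<le> Aa"
    "\<And>y. y \<in> cball x d \<Longrightarrow> norm (b y) \<le> Ab" "\<And>y. y \<in> cball x d \<Longrightarrow> norm (c y) \<le> Ac"
    using bdd[OF a] bdd[OF b] bdd[OF c] by metis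
  define A where "A = max Aa (max Ab Ac)"
  have "norm (a x) \<le> Aa" using A(1) d by simp
  then have "0 \<le> A" unfolding A_def using norm_ge_zero[of "a x"] by linarith
  then obtain N \<rho> where \<rho>: "0 \<le> \<rho>" "\<rho> < 1" and
    step: "\<And>a b c n. n \<ge> N \<Longrightarrow> norm a \<le> A \<Longrightarrow> norm b \<le> A \<Longrightarrow> norm c \<le> A \<Longrightarrow>
       norm (hyp_coeff a b c (Suc n)) * norm z ^ Suc n \<le> \<rho> * (norm (hyp_coeff a b c n) * norm z ^ n)"
    by (rule hyp_coeff_ratio_uniform[OF norm_ge_zero z]) (rule that; assumption)
  \<comment> \<open>A bound for the single coefficient of index N is enough: from there on the terms
    decay geometrically with ratio \<rho>, uniformly on the disc.\<close>
  obtain M where M: "\<And>y. y \<in> cball x d \<Longrightarrow> norm (hyp_coeff (a y) (b y) (c y) N) \<le> M"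
    using bdd[OF hol] by metis
  have bound: "norm (hyp_coeff (a y) (b y) (c y) (N + k)) * norm z ^ (N + k) \<le> M * norm z ^ N * \<rho> ^ k"
    if y: "y \<in> cball x d" for y k
  proof (induction k)
    case 0
    then show ?case using M[OF y] by (simp add: mult_right_mono)
  next
    case (Suc k)
    have "norm (hyp_coeff (a y) (b y) (c y) (N + Suc k)) * norm z ^ (N + Suc k)
        \<le> \<rho> * (norm (hyp_coeff (a y) (b y) (c y) (N + k)) * norm z ^ (N + k))"
      using step[of "N + k" "a y" "b y" "c y"] A[OF y] by (simp add: A_def le_max_iff_disj)
    also have "\<dots> \<le> \<rho> * (M * norm z ^ N * \<rho> ^ k)"
      using Suc \<rho> by (intro mult_left_mono)
    finally show ?case by (simp add: mult_ac)
  qed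
  have "uniform_limit (cball x d) (\<lambda>n y. \<Sum>i<n. hyp_coeff (a y) (b y) (c y) i * z ^ i)
      (\<lambda>y. \<Sum>i. hyp_coeff (a y) (b y) (c y) i * z ^ i) sequentially"
  proof (rule Weierstrass_m_test_ev)
    show "summable (\<lambda>n. M * norm z ^ N * \<rho> ^ (n - N))"
      using \<rho> by (subst summable_iff_shift[of _ N, symmetric]) (auto intro!: summable_mult summable_geometric)
    show "\<forall>\<^sub>F n in sequentially. \<forall>y\<in>cball x d. norm (hyp_coeff (a y) (b y) (c y) n * z ^ n) \<le> M * norm z ^ N * \<rho> ^ (n - N)"
      using eventually_ge_at_top[of N]
    proof eventually_elim
      case (elim n)
      then show ?case using bound[of _ "n - N"] by (auto simp: norm_mult norm_power)
    qed
  qed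
  then show "\<exists>d>0. cball x d \<subseteq> S \<and> uniform_limit (cball x d) (\<lambda>n x. \<Sum>i<n. hyp_coeff (a x) (b x) (c x) i * z ^ i)
      (\<lambda>x. hyp2F1 (a x) (b x) (c x) z) sequentially"
    unfolding hyp2F1_eq_suminf using d by blast
qed

section \<open>Abelian comparison with the binomial series\<close>

lemma binomial_sums_complex:
  fixes g :: complex and t :: real
  assumes "0 \<le> t" "t < 1"
  shows "(\<lambda>n. pochhammer g n / fact n * of_real t ^ n) sums (of_real (1 - t) powr (- g))"
proof -
  have "(\<lambda>n. ((- g) gchoose n) * (- of_real t) ^ n) sums (1 + (- of_real t)) powr (- g)"
    using assms by (intro gen_binomial_complex) auto
  moreover have "((- g) gchoose n) * (- of_real t) ^ n = pochhammer g n / fact n * of_real t ^ n" for n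
    unfolding gbinomial_pochhammer power_minus[of "of_real t"]
    using power_mult_distrib[of "-1" "-1 :: complex" n] by simp
  ultimately show ?thesis by simp
qed

lemma binomial_sums_real:
  fixes g t :: real
  assumes "0 \<le> t" "t < 1"
  shows "(\<lambda>n. pochhammer g n / fact n * t ^ n) sums ((1 - t) powr (- g))"
proof -
  have "(\<lambda>n. ((- g) gchoose n) * (- t) ^ n) sums (1 + (- t)) powr (- g)"
    using assms by (intro gen_binomial_real) auto
  moreover have "((- g) gchoose n) * (- t) ^ n = pochhammer g n / fact n * t ^ n" for n
    unfolding gbinomial_pochhammer power_minus[of "t"]
    using power_mult_distrib[of "-1" "-1 :: real" n] by simp
  ultimately show ?thesis by simp
qed

text \<open>The little-o form of Abel's comparison. Its gauge has a real exponent \<sigma> because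
  the comparison coefficients must be positive. The terms below N contribute at most a constant B,
  which (1 - t)^\<sigma> sends to 0; the others contribute at most e/2 after weighting.\<close>

lemma abel_summation_o:
  fixes h :: "nat \<Rightarrow> complex" and \<sigma> :: real
  assumes \<sigma>: "\<sigma> > 0" and lim: "(\<lambda>n. norm (h n) / (pochhammer \<sigma> n / fact n)) \<longlonglongrightarrow> 0"
  shows "\<And>t. 0 \<le> t \<Longrightarrow> t < 1 \<Longrightarrow> summable (\<lambda>n. h n * of_real t ^ n)"
    and "((\<lambda>t. (1 - t) powr \<sigma> * norm (\<Sum>n. h n * of_real t ^ n)) \<longlongrightarrow> 0) (at_left 1)"
proof -
  define p where "p n = pochhammer \<sigma> n / fact n" for n
  have p: "p n > 0" for n using \<sigma> by (simp add: p_def pochhammer_pos)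
  have psum: "(\<lambda>n. p n * t ^ n) sums ((1 - t) powr (- \<sigma>))" if "0 \<le> t" "t < 1" for t
    unfolding p_def using that by (rule binomial_sums_real)
  have ev: "\<exists>N. \<forall>n\<ge>N. norm (h n) \<le> e * p n" if "e > 0" for e
  proof -
    have "\<forall>\<^sub>F n in sequentially. norm (h n) / p n < e"
      using lim that unfolding p_def by (intro order_tendstoD)
    then obtain N where "\<And>n. n \<ge> N \<Longrightarrow> norm (h n) / p n < e"
      by (auto simp: eventually_sequentially)
    then show ?thesis using p by (intro exI[of _ N]) (auto simp: field_simps less_imp_le)
  qed
  show summ: "summable (\<lambda>n. h n * of_real t ^ n)" if t: "0 \<le> t" "t < 1" for t :: real
  proof -
    obtain N where N: "\<And>n. n \<ge> N \<Longrightarrow> norm (h n) \<le> 1 * p n" using ev[of 1] by auto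
    show ?thesis
    proof (rule summable_comparison_test)
      show "summable (\<lambda>n. p n * t ^ n)" using psum[OF t] by (rule sums_summable)
      show "\<exists>N. \<forall>n\<ge>N. norm (h n * complex_of_real t ^ n) \<le> p n * t ^ n"
        using N t by (intro exI[of _ N]) (auto simp: norm_mult norm_power intro!: mult_right_mono)
    qed
  qed
  show "((\<lambda>t. (1 - t) powr \<sigma> * norm (\<Sum>n. h n * of_real t ^ n)) \<longlongrightarrow> 0) (at_left 1)"
  proof (rule tendstoI)
    fix e :: real assume e: "e > 0"
    obtain N where N: "\<And>n. n \<ge> N \<Longrightarrow> norm (h n) \<le> e/2 * p n" using ev[of "e/2"] e by auto
    define B where "B = (\<Sum>n<N. norm (h n))"
    have bound: "norm (\<Sum>n. h n * of_real t ^ n) \<le> B + e/2 * (1 - t) powr (- \<sigma>)"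
      if t: "0 \<le> t" "t < 1" for t :: real
    proof -
      have s1: "(\<lambda>n. if n \<in> {..<N} then norm (h n) else 0) sums B"
        unfolding B_def by (rule sums_If_finite_set) simp
      have s2: "(\<lambda>n. (if n \<in> {..<N} then norm (h n) else 0) + e/2 * (p n * t ^ n)) sums (B + e/2 * (1 - t) powr (- \<sigma>))"
        by (intro sums_add s1 sums_mult psum t)
      have "norm (h n * of_real t ^ n) \<le> (if n \<in> {..<N} then norm (h n) else 0) + e/2 * (p n * t ^ n)" for n
      proof (cases "n < N")
        case True
        have "norm (h n) * t ^ n \<le> norm (h n) * 1"
          using t by (intro mult_left_mono power_le_one) auto
        moreover have "0 \<le> e/2 * (p n * t ^ n)" using e p[of n] t by simp
        ultimately show ?thesis using True t by (simp add: norm_mult norm_power)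
      next
        case False
        then have "norm (h n) * t ^ n \<le> (e/2 * p n) * t ^ n"
          using N[of n] t by (intro mult_right_mono) auto
        then show ?thesis using False t by (simp add: norm_mult norm_power mult_ac)
      qed
      then have "norm (\<Sum>n. h n * of_real t ^ n) \<le> (\<Sum>n. (if n \<in> {..<N} then norm (h n) else 0) + e/2 * (p n * t ^ n))"
        by (rule norm_suminf_le) (rule sums_summable[OF s2])
      then show ?thesis using sums_unique[OF s2] by simp
    qed
    have "((\<lambda>t. (1 - t) powr \<sigma> * B) \<longlongrightarrow> 0 * B) (at_left 1)"
      using \<sigma> by (intro tendsto_mult tendsto_const) real_asymp
    then have "\<forall>\<^sub>F t in at_left 1. (1 - t) powr \<sigma> * B < e/2"
      using e by (intro order_tendstoD) auto
    moreover have "\<forall>\<^sub>F t in at_left (1::real). 0 \<le> t \<and> t < 1"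
      using eventually_at_left_real[of 0 1] by (auto elim: eventually_mono)
    ultimately show "\<forall>\<^sub>F t in at_left 1. dist ((1 - t) powr \<sigma> * norm (\<Sum>n. h n * of_real t ^ n)) 0 < e"
    proof eventually_elim
      case (elim t)
      have "(1 - t) powr \<sigma> * norm (\<Sum>n. h n * of_real t ^ n) \<le> (1 - t) powr \<sigma> * (B + e/2 * (1 - t) powr (- \<sigma>))"
        using bound[of t] elim by (intro mult_left_mono) auto
      also have "\<dots> = (1 - t) powr \<sigma> * B + e/2"
        using elim by (simp add: algebra_simps powr_minus)
      also have "\<dots> < e" using elim by simp
      finally show ?case by (simp add: abs_mult)
    qed
  qed
qed

text \<open>Passes from the complex binomial coefficients to the positive ones with exponent Re g.
  Both have order n^(Re g - 1): in the quotient of the Euler products, the powers n^g and n^(Re g)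
  have the same modulus and cancel.\<close>

lemma pochhammer_norm_ratio_limit:
  fixes g :: complex
  assumes "Re g > 0"
  shows "(\<lambda>n. norm (pochhammer g n / fact n) / (pochhammer (Re g) n / fact n)) \<longlonglongrightarrow> norm (rGamma g) / rGamma (Re g) * 1"
proof -
  have nz: "pochhammer (Re g) n \<noteq> 0" "g + of_nat n \<noteq> 0" "Re g + real n \<noteq> 0" for n
    using assms pochhammer_pos[of "Re g" n] by (auto simp: complex_eq_iff)
  \<comment> \<open>\<open>rGamma_series\<close> contains \<open>pochhammer g (Suc n)\<close>; the
    factor (Re g + n) / |g + n| removes its last factor and tends to 1.\<close>
  have "(\<lambda>n. norm (rGamma_series g n) / rGamma_series (Re g) n * ((Re g + real n) / norm (g + of_nat n)))
     \<longlonglongrightarrow> norm (rGamma g) / rGamma (Re g) * 1"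
  proof (intro tendsto_mult tendsto_divide tendsto_norm rGamma_series_LIMSEQ)
    show "rGamma (Re g) \<noteq> 0" using assms by (auto simp: rGamma_eq_zero_iff elim!: nonpos_Ints_cases)
    have "norm (g + of_nat n) = sqrt ((Re g + real n)\<^sup>2 + (Im g)\<^sup>2)" for n
      by (simp add: cmod_def)
    then show "(\<lambda>n. (Re g + real n) / norm (g + of_nat n)) \<longlonglongrightarrow> 1"
      by simp real_asymp
  qed
  moreover have "norm (rGamma_series g n) / rGamma_series (Re g) n * ((Re g + real n) / norm (g + of_nat n))
      = norm (pochhammer g n / fact n) / (pochhammer (Re g) n / fact n)" for n
    using nz[of n] unfolding rGamma_series_def
    by (simp add: norm_mult norm_divide pochhammer_Suc)
  ultimately show ?thesis by simp
qed

text \<open>Subtracting L times the binomial series, whose sum is known exactly, leaves coefficients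
  of smaller order, and the little-o version disposes of them.\<close>

lemma abel_summation_binomial:
  fixes f :: "nat \<Rightarrow> complex"
  assumes g: "Re g > 0" and lim: "(\<lambda>n. f n / (pochhammer g n / fact n)) \<longlonglongrightarrow> L"
  shows "((\<lambda>t. of_real (1 - t) powr g * (\<Sum>n. f n * of_real t ^ n)) \<longlongrightarrow> L) (at_left 1)"
proof -
  define G where "G n = pochhammer g n / fact n" for n
  define h where "h n = f n - L * G n" for n
  have G: "G n \<noteq> 0" for n
    using g by (auto simp: G_def pochhammer_eq_0_iff)
  have "(\<lambda>n. norm (f n / G n - L) * (norm (G n) / (pochhammer (Re g) n / fact n)))
      \<longlonglongrightarrow> norm (L - L) * (norm (rGamma g) / rGamma (Re g) * 1)"
    using lim pochhammer_norm_ratio_limit[OF g] unfolding G_def by (intro tendsto_intros)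
  moreover have "norm (f n / G n - L) * norm (G n) = norm (h n)" for n
    using G[of n] by (simp add: h_def divide_simps flip: norm_mult)
  ultimately have small: "(\<lambda>n. norm (h n) / (pochhammer (Re g) n / fact n)) \<longlonglongrightarrow> 0"
    by (simp only: times_divide_eq_right[of _ "norm (G _)"] diff_self norm_zero mult_zero_left)
  note abel = abel_summation_o[OF g small]
  have "((\<lambda>t. of_real (1 - t) powr g * (\<Sum>n. h n * of_real t ^ n)) \<longlongrightarrow> 0) (at_left 1)"
  proof (rule tendsto_norm_zero_cancel, rule Lim_transform_eventually[OF abel(2)])
    show "\<forall>\<^sub>F t in at_left 1. (1 - t) powr Re g * norm (\<Sum>n. h n * of_real t ^ n) =
        norm (of_real (1 - t) powr g * (\<Sum>n. h n * of_real t ^ n))"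
      using eventually_at_left_real[of 0 1]
      by (auto elim!: eventually_mono simp: norm_mult norm_powr_real_powr simp flip: of_real_diff)
  qed
  then have "((\<lambda>t. of_real (1 - t) powr g * (\<Sum>n. h n * of_real t ^ n) + L) \<longlongrightarrow> 0 + L) (at_left 1)"
    by (intro tendsto_intros)
  moreover have "\<forall>\<^sub>F t in at_left 1. of_real (1 - t) powr g * (\<Sum>n. h n * of_real t ^ n) + L
      = of_real (1 - t) powr g * (\<Sum>n. f n * of_real t ^ n)"
    using eventually_at_left_real[of 0 "1::real", simplified]
  proof (eventually_elim)
    case (elim t)
    then have t: "0 \<le> t" "t < 1" by auto
    have "(\<lambda>n. h n * of_real t ^ n + L * (G n * of_real t ^ n)) sums
        ((\<Sum>n. h n * of_real t ^ n) + L * of_real (1 - t) powr (- g))"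
      using summable_sums[OF abel(1)[OF t]] binomial_sums_complex[OF t, of g]
      unfolding G_def by (intro sums_add sums_mult)
    then have "(\<Sum>n. f n * of_real t ^ n) = (\<Sum>n. h n * of_real t ^ n) + L * of_real (1 - t) powr (- g)"
      by (simp add: h_def algebra_simps sums_iff)
    moreover have "complex_of_real (1 - t) powr g \<noteq> 0"
      using t by (simp flip: of_real_diff)
    ultimately show ?case
      by (simp only: powr_minus distrib_left) simp
  qed
  ultimately show ?thesis
    unfolding add_0_left by (rule Lim_transform_eventually)
qed

text \<open>The number g is the exponent of the singularity of F' at 1. The coefficients of F'
  divided by those of (1 - t)^(-g) form a quotient of four Euler products, for a, b, c and g, whence
  the four Gamma factors.\<close>

lemma hyp2F1_limits_at_1:
  fixes a b c g :: complex
  assumes c: "c \<notin> \<int>\<^sub>\<le>\<^sub>0" and g: "Re g > 0" and gdef: "g = a + b + 1 - c"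
  shows "((\<lambda>t. of_real (1 - t) powr g * (a * b / c * hyp2F1 (a + 1) (b + 1) (c + 1) (of_real t)))
      \<longlongrightarrow> Gamma c * Gamma g * rGamma a * rGamma b) (at_left 1)"
    and "((\<lambda>t. of_real (1 - t) powr g * hyp2F1 a b c (of_real t)) \<longlongrightarrow> 0) (at_left 1)"
proof -
  define G where "G n = pochhammer g n / fact n" for n
  define f where "f n = a * b / c * hyp_coeff (a + 1) (b + 1) (c + 1) n" for n
  have gn: "g + of_nat n \<noteq> 0" for n using g by (auto simp: complex_eq_iff)
  have gnp: "g \<notin> \<int>\<^sub>\<le>\<^sub>0" using g by (auto elim!: nonpos_Ints_cases)
  have G: "G n \<noteq> 0" for n
    using g by (auto simp: G_def pochhammer_eq_0_iff)
  \<comment> \<open>This correction has two sources: g + n appears because the Euler product for g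
    has one factor more than the binomial coefficient, and 1/n because c + g = a + b + 1 leaves one
    power of n over.\<close>
  have "(\<lambda>n. (g + of_nat n) / of_nat n) \<longlonglongrightarrow> 1"
  proof -
    have "(\<lambda>n. g / of_nat n + 1) \<longlonglongrightarrow> 0 + 1"
      by (intro tendsto_intros lim_const_over_n)
    then have "(\<lambda>n. g / of_nat n + 1) \<longlonglongrightarrow> 1" by simp
    then show ?thesis
      by (rule Lim_transform_eventually)
        (use eventually_gt_at_top[of 0] in eventually_elim, auto simp: field_simps)
  qed
  then have "(\<lambda>n. rGamma_series a n * rGamma_series b n / (rGamma_series c n * rGamma_series g n)
      * ((g + of_nat n) / of_nat n)) \<longlonglongrightarrow> rGamma a * rGamma b / (rGamma c * rGamma g) * 1"
    using c gnp by (intro tendsto_intros) (auto simp: rGamma_eq_zero_iff)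
  then have lim: "(\<lambda>n. f n / G n) \<longlonglongrightarrow> rGamma a * rGamma b / (rGamma c * rGamma g) * 1"
  proof (rule Lim_transform_eventually)
    show "\<forall>\<^sub>F n in sequentially. rGamma_series a n * rGamma_series b n / (rGamma_series c n * rGamma_series g n)
      * ((g + of_nat n) / of_nat n) = f n / G n"
      using eventually_gt_at_top[of 0]
    proof eventually_elim
      case (elim n)
      define E where "E z = exp (z * of_real (ln (real n)))" for z :: complex
      have E: "E z \<noteq> 0" for z by (simp add: E_def)
      have "E c * E g = E (a + b + 1)" unfolding gdef E_def by (simp flip: exp_add add: algebra_simps)
      also have "\<dots> = E a * E b * of_nat n"
        using elim by (simp add: E_def algebra_simps exp_add exp_of_real)
      finally have EE: "E a * E b * of_nat n = E c * E g" by simp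
      have fn: "f n = pochhammer a (Suc n) * pochhammer b (Suc n) / (pochhammer c (Suc n) * fact n)"
        by (simp add: f_def hyp_coeff_def pochhammer_rec mult_ac)
      have "rGamma_series a n * rGamma_series b n / (rGamma_series c n * rGamma_series g n)
          * ((g + of_nat n) / of_nat n) =
          pochhammer a (Suc n) * pochhammer b (Suc n) / (pochhammer c (Suc n) * pochhammer g n) * (E c * E g / (E a * E b * of_nat n))"
        unfolding rGamma_series_def E_def[symmetric] using E gn[of n]
        by (simp add: pochhammer_Suc[of g n] mult_ac)
      also have "\<dots> = f n / G n" unfolding EE fn G_def using E by simp
      finally show ?case .
    qed
  qed
  have eq: "(\<Sum>n. f n * of_real s ^ n) = a * b / c * hyp2F1 (a + 1) (b + 1) (c + 1) (of_real s)"
    if "0 < s" "s < 1" for s :: real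
  proof -
    have "(\<lambda>n. a * b / c * (hyp_coeff (a + 1) (b + 1) (c + 1) n * of_real s ^ n)) sums
       (a * b / c * (\<Sum>n. hyp_coeff (a + 1) (b + 1) (c + 1) n * of_real s ^ n))"
      using that by (intro sums_mult summable_sums summable_hyp_term) auto
    then show ?thesis unfolding f_def hyp2F1_eq_suminf mult.assoc[of "a * b / c"] by (rule sums_unique[symmetric])
  qed
  have "((\<lambda>t. of_real (1 - t) powr g * (a * b / c * hyp2F1 (a + 1) (b + 1) (c + 1) (of_real t)))
      \<longlongrightarrow> rGamma a * rGamma b / (rGamma c * rGamma g) * 1) (at_left 1)"
    by (rule Lim_transform_eventually[OF abel_summation_binomial[OF g lim[unfolded G_def]]])
      (use eventually_at_left_real[of 0 "1::real", simplified] in eventually_elim, auto simp: eq)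
  then show "((\<lambda>t. of_real (1 - t) powr g * (a * b / c * hyp2F1 (a + 1) (b + 1) (c + 1) (of_real t)))
      \<longlongrightarrow> Gamma c * Gamma g * rGamma a * rGamma b) (at_left 1)"
    by (simp add: Gamma_def divide_inverse mult_ac)
  \<comment> \<open>Integrating F' gains one order: relative to the same binomial series, the
    coefficients of F are smaller than those of F' by the factor 1 / (g + n).\<close>
  have "(\<lambda>n. 1 / (g + of_nat n)) \<longlonglongrightarrow> 0"
    by (intro tendsto_divide_0[OF tendsto_const] tendsto_add_filterlim_at_infinity[OF tendsto_const] tendsto_of_nat)
  then have "(\<lambda>n. f n / G n * (1 / (g + of_nat n))) \<longlonglongrightarrow> rGamma a * rGamma b / (rGamma c * rGamma g) * 1 * 0"
    by (intro tendsto_mult lim)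
  moreover have "f n / G n * (1 / (g + of_nat n)) = hyp_coeff a b c (Suc n) / G (Suc n)" for n
    unfolding f_def G_def hyp_coeff_def pochhammer_Suc[of g n] pochhammer_rec[of a] pochhammer_rec[of b] pochhammer_rec[of c]
    using gn[of n] by (simp add: mult_ac del: of_nat_Suc)
  ultimately have "(\<lambda>n. hyp_coeff a b c (Suc n) / G (Suc n)) \<longlonglongrightarrow> 0"
    by (simp only: mult_zero_right)
  then have "(\<lambda>n. hyp_coeff a b c n / G n) \<longlonglongrightarrow> 0"
    by (rule LIMSEQ_imp_Suc)
  from abel_summation_binomial[OF g this[unfolded G_def]]
  show "((\<lambda>t. of_real (1 - t) powr g * hyp2F1 a b c (of_real t)) \<longlongrightarrow> 0) (at_left 1)"
    by (simp only: hyp2F1_eq_suminf)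
qed

section \<open>Linear second-order equations\<close>

definition solves :: "(real \<Rightarrow> complex) \<Rightarrow> (real \<Rightarrow> complex) \<Rightarrow> bool" where
  "solves Q f \<longleftrightarrow> (\<exists>f1. \<forall>x. (f has_vector_derivative f1 x) (at x) \<and>
                            (f1 has_vector_derivative Q x * f x) (at x))"

lemma wronskian_constant:
  fixes f g :: "real \<Rightarrow> complex"
  assumes f: "\<And>x. (f has_vector_derivative f1 x) (at x)" "\<And>x. (f1 has_vector_derivative Q x * f x) (at x)"
    and g: "\<And>x. (g has_vector_derivative g1 x) (at x)" "\<And>x. (g1 has_vector_derivative Q x * g x) (at x)"
  shows "f x * g1 x - f1 x * g x = f y * g1 y - f1 y * g y"
proof -
  have "((\<lambda>x. f x * g1 x - f1 x * g x) has_vector_derivative 0) (at x)" for x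
  proof -
    have "((\<lambda>x. f x * g1 x - f1 x * g x) has_vector_derivative
        (f x * (Q x * g x) + f1 x * g1 x) - (f1 x * g1 x + Q x * f x * g x)) (at x)"
      by (intro has_vector_derivative_diff has_vector_derivative_mult f g)
    then show ?thesis by (simp add: mult_ac)
  qed
  then show ?thesis
    using has_vector_derivative_zero_constant[of UNIV "\<lambda>x. f x * g1 x - f1 x * g x"] by (metis UNIV_I convex_UNIV)
qed

lemma zero_initial_values:
  fixes h h1 Q :: "real \<Rightarrow> complex"
  assumes h: "\<And>x. (h has_vector_derivative h1 x) (at x)"
    and h1: "\<And>x. (h1 has_vector_derivative Q x * h x) (at x)"
    and Q: "\<And>x. norm (Q x) \<le> M" and init: "h x0 = 0" "h1 x0 = 0"
  shows "h x = 0"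
proof -
  \<comment> \<open>Gronwall for the energy: \<open>E exp(- K x)\<close> decreases and \<open>E exp(K x)\<close> increases.\<close>
  define E where "E x = inner (h x) (h x) + inner (h1 x) (h1 x)" for x
  define E1 where "E1 x = 2 * inner (h x) (h1 x) + 2 * inner (h1 x) (Q x * h x)" for x
  define K where "K = 1 + M"
  have E0: "0 \<le> E x" for x by (simp add: E_def)
  have dE: "(E has_real_derivative E1 x) (at x)" for x
    unfolding E_def[abs_def] E1_def has_real_derivative_iff_has_vector_derivative
    using h[of x] h1[of x] unfolding has_vector_derivative_def
    by (auto intro!: derivative_eq_intros simp: algebra_simps inner_commute)
  have bound: "\<bar>E1 x\<bar> \<le> K * E x" for x
  proof -
    have "\<bar>inner (h x) (h1 x)\<bar> \<le> norm (h x) * norm (h1 x)"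
      by (rule Cauchy_Schwarz_ineq2)
    moreover have "\<bar>inner (h1 x) (Q x * h x)\<bar> \<le> norm (h1 x) * (M * norm (h x))"
      by (rule order_trans[OF Cauchy_Schwarz_ineq2])
        (auto simp: norm_mult intro!: mult_left_mono mult_right_mono Q)
    ultimately have "\<bar>E1 x\<bar> \<le> K * (2 * norm (h x) * norm (h1 x))"
      unfolding E1_def K_def by (simp add: algebra_simps)
    also have "\<dots> \<le> K * E x"
    proof (rule mult_left_mono)
      show "2 * norm (h x) * norm (h1 x) \<le> E x"
        using sum_squares_bound[of "norm (h x)" "norm (h1 x)"] by (simp add: E_def dot_square_norm)
      show "0 \<le> K" using Q[of 0] norm_ge_zero[of "Q 0"] unfolding K_def by linarith
    qed
    finally show ?thesis .
  qed
  have "E x \<le> 0"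
  proof (cases "x0 \<le> x")
    case True
    have "E x * exp (- K * x) \<le> E x0 * exp (- K * x0)"
    proof (rule DERIV_nonpos_imp_nonincreasing[OF True])
      fix y
      have "((\<lambda>x. E x * exp (- K * x)) has_real_derivative (E1 y - K * E y) * exp (- K * y)) (at y)"
        by (auto intro!: derivative_eq_intros dE simp: algebra_simps)
      moreover have "(E1 y - K * E y) * exp (- K * y) \<le> 0"
        using bound[of y] by (intro mult_nonpos_nonneg) auto
      ultimately show "\<exists>d. ((\<lambda>x. E x * exp (- K * x)) has_real_derivative d) (at y) \<and> d \<le> 0"
        by blast
    qed
    then show ?thesis using init by (simp add: E_def mult_le_0_iff)
  next
    case False
    then have "x \<le> x0" by simp
    then have "E x * exp (K * x) \<le> E x0 * exp (K * x0)"
    proof (rule DERIV_nonneg_imp_nondecreasing)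
      fix y
      have "((\<lambda>x. E x * exp (K * x)) has_real_derivative (E1 y + K * E y) * exp (K * y)) (at y)"
        by (auto intro!: derivative_eq_intros dE simp: algebra_simps)
      moreover have "(E1 y + K * E y) * exp (K * y) \<ge> 0"
        using bound[of y] by (intro mult_nonneg_nonneg) auto
      ultimately show "\<exists>d. ((\<lambda>x. E x * exp (K * x)) has_real_derivative d) (at y) \<and> 0 \<le> d"
        by blast
    qed
    then show ?thesis using init by (simp add: E_def mult_le_0_iff)
  qed
  then have "inner (h x) (h x) \<le> 0"
    unfolding E_def using inner_ge_zero[of "h1 x"] by linarith
  then show "h x = 0"
    using inner_gt_zero_iff[of "h x"] by linarith
qed

section \<open>Uniqueness from the asymptotics at -infinity\<close>

lemma asymp_equiv_exp_iff:
  fixes f :: "real \<Rightarrow> complex"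
  shows "f \<sim>[F] (\<lambda>x. exp (g x)) \<longleftrightarrow> ((\<lambda>x. f x * exp (- g x)) \<longlongrightarrow> 1) F"
  by (simp add: asymp_equiv_def exp_minus divide_inverse)

text \<open>The sign of Re \<alpha> enters through |exp (2 \<alpha> x)| \<le> 1 for x \<le> 0, which
  keeps p bounded. The bound M on the potential serves to extend the equality from a half-line to
  all x.\<close>

lemma asymptotic_solution_unique:
  fixes f p Q :: "real \<Rightarrow> complex" and \<alpha> :: complex
  assumes f: "solves Q f" and p: "solves Q p" and Q: "\<And>x. norm (Q x) \<le> M"
    and f_asymp: "f \<sim>[at_bot] (\<lambda>x. exp (\<alpha> * of_real x))"
    and p_asymp: "p \<sim>[at_bot] (\<lambda>x. exp (\<alpha> * of_real x))" and \<alpha>: "Re \<alpha> \<ge> 0"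
  shows "f = p"
proof -
  obtain f1 where f1: "\<And>x. (f has_vector_derivative f1 x) (at x)" "\<And>x. (f1 has_vector_derivative Q x * f x) (at x)"
    using f by (auto simp: solves_def)
  obtain p1 where p1: "\<And>x. (p has_vector_derivative p1 x) (at x)" "\<And>x. (p1 has_vector_derivative Q x * p x) (at x)"
    using p by (auto simp: solves_def)
  define C where "C = p 0 * f1 0 - p1 0 * f 0"
  have C: "p x * f1 x - p1 x * f x = C" for x
    unfolding C_def by (rule wronskian_constant[OF p1 f1])
  define r where "r x = f x / p x" for x
  \<comment> \<open>The square of p with its exponential divided out. It tends to 1, so 1/p^2 is exp
    (-2 \<alpha> x) up to a factor close to 1.\<close>
  define m where "m x = (p x * exp (- \<alpha> * of_real x))\<^sup>2" for x
  have p_lim: "((\<lambda>x. p x * exp (- \<alpha> * of_real x)) \<longlongrightarrow> 1) at_bot"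
    using p_asymp by (simp add: asymp_equiv_exp_iff)
  have f_lim: "((\<lambda>x. f x * exp (- \<alpha> * of_real x)) \<longlongrightarrow> 1) at_bot"
    using f_asymp by (simp add: asymp_equiv_exp_iff)
  have "((\<lambda>x. f x * exp (- \<alpha> * of_real x) / (p x * exp (- \<alpha> * of_real x))) \<longlongrightarrow> 1 / 1) at_bot"
    by (intro tendsto_divide f_lim p_lim) simp
  then have r_lim: "(r \<longlongrightarrow> 1) at_bot"
    by (simp add: r_def[abs_def])
  have m_lim: "(m \<longlongrightarrow> 1) at_bot"
    unfolding m_def[abs_def] using tendsto_power[OF p_lim, of 2] by simp
  have "\<forall>\<^sub>F x in at_bot. dist (m x) 1 < 1/10"
    by (rule tendstoD[OF m_lim]) simp
  then obtain B0 where B0: "\<And>x. x \<le> B0 \<Longrightarrow> norm (m x - 1) < 1/10"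
    by (auto simp: eventually_at_bot_linorder dist_norm)
  \<comment> \<open>The bound 0 is there for |exp (2 \<alpha> x)| \<le> 1.\<close>
  define B where "B = min B0 0"
  have m: "norm (m x - 1) \<le> 1/10" if "x \<le> B" for x
    using B0[of x] that by (simp add: B_def)
  have p_nz: "p x \<noteq> 0" if "x \<le> B" for x
    using m[OF that] by (auto simp: m_def)
  have dr: "(r has_vector_derivative C / (p x)\<^sup>2) (at x)" if "x \<le> B" for x
  proof -
    have "(r has_vector_derivative (f1 x * p x - f x * p1 x) / (p x * p x)) (at x)"
      unfolding r_def[abs_def] has_vector_derivative_def
      using f1(1)[of x] p1(1)[of x] p_nz[OF that] unfolding has_vector_derivative_def
      by (auto intro!: derivative_eq_intros simp: field_simps scaleR_conv_of_real)
    then show ?thesis using C[of x] by (simp add: power2_eq_square mult_ac)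
  qed
  have "C = 0"
  proof (rule ccontr)
    assume C0: "C \<noteq> 0"
    have "((\<lambda>y. exp (2 * \<alpha> * of_real y)) \<longlongrightarrow> exp (2 * \<alpha> * of_real 0)) (at (0::real))"
      by (intro tendsto_intros)
    then have "\<forall>\<^sub>F y in at (0::real). dist (exp (2 * \<alpha> * of_real y)) 1 < 1/10"
      by (intro tendstoD) auto
    then obtain d where d: "d > 0" "\<And>y::real. y \<noteq> 0 \<Longrightarrow> \<bar>y\<bar> < d \<Longrightarrow> norm (exp (2 * \<alpha> * of_real y) - 1) < 1/10"
      by (auto simp: eventually_at dist_norm)
    define \<tau> where "\<tau> = d / 2"
    have \<tau>: "\<tau> > 0" using d by (simp add: \<tau>_def)
    have e: "norm (exp (2 * \<alpha> * of_real y) - 1) \<le> 1/10" if "0 \<le> y" "y \<le> \<tau>" for y :: real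
      using d(2)[of y] d(1) that by (cases "y = 0") (auto simp: \<tau>_def)
    \<comment> \<open>\<open>r' = C / p\<^sup>2\<close> is nearly constant on the short interval \<open>[x - \<tau>, x]\<close>; this also covers \<open>\<alpha> = 0\<close>.\<close>
    have gap: "norm (r x - r (x - \<tau>)) \<ge> \<tau> * norm C / 4" if x: "x \<le> B" for x
    proof -
      define R where "R y = C / (p y)\<^sup>2" for y
      \<comment> \<open>R y / R x is a quotient of three numbers within 1/10 of 1, namely m x, w and
        m y. The numerator error is at most 3/10 + 1/100 and the denominator at least 9/10, and
        (31/100) / (9/10) < 1/2.\<close>
      have near: "norm (R y - R x) \<le> norm (R x) / 2" if y: "y \<in> {x - \<tau>..x}" for y
      proof -
        define w where "w = exp (2 * \<alpha> * of_real (x - y))"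
        have w: "norm (w - 1) \<le> 1/10" unfolding w_def using y by (intro e) auto
        have mx: "norm (m x - 1) \<le> 1/10" and my: "norm (m y - 1) \<le> 1/10" using m[of x] m[of y] x y by auto
        have my_nz: "m y \<noteq> 0" using my by auto
        have px: "(p x)\<^sup>2 = m x * exp (2 * \<alpha> * of_real x)" for x
          by (simp add: m_def power_mult_distrib power2_eq_square flip: exp_add)
        have ratio: "R y = R x * (m x * w / m y)"
          using p_nz[of x] p_nz[of y] x y unfolding R_def px w_def
          by (simp add: m_def field_simps exp_diff)
        have "norm (m x * w - m y) = norm ((m x - 1) - (m y - 1) + (w - 1) + (m x - 1) * (w - 1))"
          by (simp add: algebra_simps)
        also have "\<dots> \<le> 1/10 + 1/10 + 1/10 + 1/10 * (1/10)"
          by (intro norm_triangle_mono norm_triangle_le_diff add_mono w mx my order_trans[OF norm_mult_ineq] mult_mono) auto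
        finally have 1: "norm (m x * w - m y) \<le> 31/100" by simp
        have 2: "norm (m y) \<ge> 9/10"
          using norm_triangle_ineq2[of 1 "1 - m y"] my by (simp add: norm_minus_commute)
        have "R y - R x = R x * ((m x * w - m y) / m y)"
          using my_nz by (simp add: ratio field_simps)
        then have "norm (R y - R x) = norm (R x) * (norm (m x * w - m y) / norm (m y))"
          by (simp add: norm_mult norm_divide)
        also have "\<dots> \<le> norm (R x) * ((31/100) / (9/10))"
          using 1 2 by (intro mult_left_mono frac_le) auto
        also have "\<dots> \<le> norm (R x) * (1/2)"
          by (intro mult_left_mono) auto
        finally show ?thesis by simp
      qed
      \<comment> \<open>Mean value inequality for r minus its linearization: the increment of r
        differs from \<tau> R x by at most half its size, so no cancellation can occur.\<close>
      have "norm (r x - r (x - \<tau>) - (x - (x - \<tau>)) *\<^sub>R R x) \<le> norm (x - (x - \<tau>)) * (norm (R x) / 2)"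
      proof (rule vector_differentiable_bound_linearization[where S = "{x - \<tau>..x}" and f' = R])
        show "(r has_vector_derivative R y) (at y within {x - \<tau>..x})" if "y \<in> {x - \<tau>..x}" for y
          using that x unfolding R_def by (auto intro: has_vector_derivative_at_within[OF dr])
        show "closed_segment (x - \<tau>) x \<subseteq> {x - \<tau>..x}" "x \<in> {x - \<tau>..x}"
          using \<tau> by (auto simp: closed_segment_eq_real_ivl)
      qed (rule near)
      then have "norm (r x - r (x - \<tau>) - \<tau> *\<^sub>R R x) \<le> \<tau> * (norm (R x) / 2)"
        using \<tau> by simp
      moreover have "norm (\<tau> *\<^sub>R R x) = \<tau> * norm (R x)" using \<tau> by simp
      ultimately have ge: "norm (r x - r (x - \<tau>)) \<ge> \<tau> * (norm (R x) / 2)"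
        using \<tau> norm_triangle_ineq2[of "\<tau> *\<^sub>R R x" "\<tau> *\<^sub>R R x - (r x - r (x - \<tau>))"]
        by (simp add: norm_minus_commute)
      have "(p x)\<^sup>2 = m x * exp (2 * \<alpha> * of_real x)"
        by (simp add: m_def power_mult_distrib power2_eq_square flip: exp_add)
      moreover have "norm (m x) \<le> 2"
        using norm_triangle_ineq[of 1 "m x - 1"] m[OF x] by simp
      moreover have "norm (exp (2 * \<alpha> * of_real x)) \<le> 1"
        using \<alpha> x by (auto simp: B_def mult_nonneg_nonpos)
      ultimately have "norm ((p x)\<^sup>2) \<le> 2 * 1"
        unfolding norm_mult by (metis mult_mono norm_ge_zero norm_mult zero_le_numeral)
      moreover have "norm ((p x)\<^sup>2) > 0" using p_nz[OF x] by simp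
      ultimately have "norm (R x) \<ge> norm C / 2"
        unfolding R_def norm_divide by (intro divide_left_mono) auto
      then have "\<tau> * (norm (R x) / 2) \<ge> \<tau> * (norm C / 4)"
        using \<tau> by (intro mult_left_mono) auto
      with ge show ?thesis by simp
    qed
    \<comment> \<open>Since r converges, its increments over the fixed length \<tau> tend to 0,
      which contradicts the lower bound \<open>gap\<close>.\<close>
    have "filterlim (\<lambda>x. x - \<tau>) at_bot at_bot" by real_asymp
    then have "((\<lambda>x. norm (r x - r (x - \<tau>))) \<longlongrightarrow> norm (1 - 1 :: complex)) at_bot"
      by (intro tendsto_norm tendsto_diff r_lim filterlim_compose[OF r_lim])
    moreover have "\<forall>\<^sub>F x in at_bot. \<tau> * norm C / 4 \<le> norm (r x - r (x - \<tau>))"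
      using eventually_le_at_bot[of B] by eventually_elim (rule gap)
    ultimately have "\<tau> * norm C / 4 \<le> norm (1 - 1 :: complex)"
      by (intro tendsto_lowerbound) auto
    then show False using \<tau> C0 by (simp add: mult_le_0_iff)
  qed
  then have "(r has_vector_derivative 0) (at x within {..B})" if "x \<in> {..B}" for x
    using has_vector_derivative_at_within[OF dr[of x]] that by simp
  then obtain k where k: "\<And>x. x \<in> {..B} \<Longrightarrow> r x = k"
    using has_vector_derivative_zero_constant[of "{..B}" r] by auto
  have "(r \<longlongrightarrow> k) at_bot"
    by (rule tendsto_eventually) (use eventually_le_at_bot[of B] in eventually_elim, simp add: k)
  then have "k = 1"
    using r_lim tendsto_unique[of at_bot r] by simp
  then have eq: "f x = p x" if "x \<le> B" for x
    using k[of x] p_nz[OF that] that by (simp add: r_def)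
  \<comment> \<open>Derivatives can be compared only at a point with a neighbourhood on which f = p,
    hence B - 1 instead of B. With equal value and derivative there,
    \<open>zero_initial_values\<close> applies to f - p.\<close>
  have "(f has_vector_derivative p1 (B - 1)) (at (B - 1))"
    by (rule has_vector_derivative_transform_within_open[OF p1(1), where S = "{..<B}"]) (auto simp: eq)
  then have "f1 (B - 1) = p1 (B - 1)"
    using f1(1) vector_derivative_unique_at by blast
  then have "f x - p x = 0" for x
    using zero_initial_values[of "\<lambda>x. f x - p x" "\<lambda>x. f1 x - p1 x" Q M "B - 1" x] f1 p1 Q eq[of "B - 1"]
    by (auto simp: right_diff_distrib intro!: has_vector_derivative_diff)
  then show ?thesis by auto
qed

section \<open>The mode equation\<close>

lemma u_of_eq: "u_of v = 1 / (1 + exp (- v))"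
  unfolding u_of_def
proof (rule the_equality)
  have pos: "0 < 1 + exp (- v)" by (simp add: add_pos_pos)
  have "1 - 1 / (1 + exp (- v)) = exp (- v) / (1 + exp (- v))"
    using pos by (simp add: field_simps)
  then show "0 < 1 / (1 + exp (- v)) \<and> 1 / (1 + exp (- v)) < 1 \<and>
      v = ln (1 / (1 + exp (- v))) - ln (1 - 1 / (1 + exp (- v)))"
    using pos by (simp add: ln_div)
next
  fix u assume "0 < u \<and> u < 1 \<and> v = ln u - ln (1 - u)"
  then have u: "0 < u" "u < 1" and v: "- v = ln (1 - u) - ln u" by auto
  have "exp (- v) = (1 - u) / u" unfolding v using u by (simp add: exp_diff)
  then have "1 + exp (- v) = 1 / u" using u by (simp add: diff_divide_distrib)
  then show "u = 1 / (1 + exp (- v))" by simp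
qed

lemma u_of_pos: "0 < u_of v" and u_of_less_1: "u_of v < 1"
  by (simp_all add: u_of_eq add_pos_pos)

lemma u_of_minus: "u_of (- v) = 1 - u_of v"
proof -
  have "1 + exp v \<noteq> 0" "1 + exp (- v) \<noteq> 0"
    using exp_gt_zero[of v] exp_gt_zero[of "- v"] by linarith+
  then show ?thesis
    by (simp add: u_of_eq field_simps flip: exp_add)
qed

lemma u_of_logit:
  assumes "0 < t" "t < 1"
  shows "u_of (ln t - ln (1 - t)) = t"
  using assms by (simp add: u_of_eq exp_diff field_simps)

lemma has_vector_derivative_u_of:
  "((\<lambda>x. complex_of_real (u_of x)) has_vector_derivative of_real (u_of x) * (1 - of_real (u_of x))) (at x)"
proof -
  have pos: "1 + exp (- x) \<noteq> 0" using exp_gt_zero[of "- x"] by linarith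
  have "(u_of has_real_derivative u_of x * (1 - u_of x)) (at x)"
    unfolding u_of_eq[abs_def] using pos
    by (auto intro!: derivative_eq_intros simp: field_simps power2_eq_square)
  from has_vector_derivative_of_real[OF this] show ?thesis
    by simp
qed

text \<open>Here \<alpha> and \<beta> are the exponents at z = 0 and z = 1. The parameter a = b =
  \<alpha> + \<beta> + 1/2 is symmetric in them, so exchanging the exponents changes only the third
  parameter, from 1 + 2 \<alpha> to 1 + 2 \<beta>. This is what lets a reflection produce the second
  solution.\<close>

definition mode :: "complex \<Rightarrow> complex \<Rightarrow> complex \<Rightarrow> complex" where
  "mode \<alpha> \<beta> z = z powr \<alpha> * (1 - z) powr \<beta> * hyp2F1 (\<alpha> + \<beta> + 1/2) (\<alpha> + \<beta> + 1/2) (1 + 2 * \<alpha>) z"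

text \<open>The derivative of the hypergeometric factor of \<open>mode\<close>, given by a formula
  instead of \<open>deriv\<close> so that its holomorphy in the parameters can be read off.\<close>

definition hyp_deriv :: "complex \<Rightarrow> complex \<Rightarrow> complex \<Rightarrow> complex" where
  "hyp_deriv \<alpha> \<beta> z = (\<alpha> + \<beta> + 1/2) * (\<alpha> + \<beta> + 1/2) / (1 + 2 * \<alpha>) *
     hyp2F1 (\<alpha> + \<beta> + 1/2 + 1) (\<alpha> + \<beta> + 1/2 + 1) (1 + 2 * \<alpha> + 1) z"

text \<open>\<open>z (1 - z) d/dz\<close> applied to \<^const>\<open>mode\<close>; this is the derivative in \<open>v\<close>, as \<open>du/dv = u (1 - u)\<close>.\<close>
definition mode_deriv :: "complex \<Rightarrow> complex \<Rightarrow> complex \<Rightarrow> complex" where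
  "mode_deriv \<alpha> \<beta> z = z powr \<alpha> * (1 - z) powr \<beta> *
     ((\<alpha> * (1 - z) - \<beta> * z) * hyp2F1 (\<alpha> + \<beta> + 1/2) (\<alpha> + \<beta> + 1/2) (1 + 2 * \<alpha>) z
      + z * (1 - z) * hyp_deriv \<alpha> \<beta> z)"

definition mode_potential :: "complex \<Rightarrow> complex \<Rightarrow> complex \<Rightarrow> complex" where
  "mode_potential \<alpha> \<beta> z = \<alpha>\<^sup>2 * (1 - z) + \<beta>\<^sup>2 * z + z * (1 - z) / 4"

text \<open>Stated for arbitrary h because it is applied twice: to the hypergeometric factor, and
  then to the bracket which the first application produces.\<close>

lemma has_field_derivative_powr_powr_mult:
  fixes z :: complex
  assumes z: "z \<notin> \<real>\<^sub>\<le>\<^sub>0" "1 - z \<notin> \<real>\<^sub>\<le>\<^sub>0" and h: "(h has_field_derivative h') (at z)"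
  shows "((\<lambda>z. z powr \<alpha> * (1 - z) powr \<beta> * h z) has_field_derivative
     z powr \<alpha> * (1 - z) powr \<beta> * ((\<alpha> * (1 - z) - \<beta> * z) * h z + z * (1 - z) * h') / (z * (1 - z))) (at z)"
proof -
  have nz: "z \<noteq> 0" "1 - z \<noteq> 0" using z by auto
  have A: "((\<lambda>z. z powr \<alpha>) has_field_derivative \<alpha> * (z powr \<alpha> / z)) (at z)"
    using has_field_derivative_powr[OF z(1), of \<alpha>] nz by (simp add: powr_diff)
  have B: "((\<lambda>z. (1 - z) powr \<beta>) has_field_derivative - \<beta> * ((1 - z) powr \<beta> / (1 - z))) (at z)"
  proof -
    have "((\<lambda>z. (1 - z) powr \<beta>) has_field_derivative (\<beta> * (1 - z) powr (\<beta> - 1)) * (0 - 1)) (at z)"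
      by (rule DERIV_chain2[where f = "\<lambda>w. w powr \<beta>" and g = "\<lambda>z. 1 - z"])
        (auto intro!: has_field_derivative_powr z derivative_eq_intros)
    then show ?thesis using nz by (simp add: powr_diff)
  qed
  define P R where "P = z powr \<alpha>" and "R = (1 - z) powr \<beta>"
  have "((\<lambda>z. z powr \<alpha> * (1 - z) powr \<beta> * h z) has_field_derivative
     (\<alpha> * (P / z) * R + (- \<beta> * (R / (1 - z))) * P) * h z + h' * (P * R)) (at z)"
    unfolding P_def R_def by (intro DERIV_mult A B h)
  also have "(\<alpha> * (P / z) * R + (- \<beta> * (R / (1 - z))) * P) * h z + h' * (P * R) =
      P * R * ((\<alpha> * (1 - z) - \<beta> * z) * h z + z * (1 - z) * h') / (z * (1 - z))"
    using nz by (simp add: divide_simps) (simp add: algebra_simps)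
  finally show ?thesis unfolding P_def R_def .
qed

context
  fixes \<alpha> \<beta> :: complex
  assumes c: "1 + 2 * \<alpha> \<notin> \<int>\<^sub>\<le>\<^sub>0"
begin

lemma has_field_derivative_mode:
  assumes z: "z \<notin> \<real>\<^sub>\<le>\<^sub>0" "1 - z \<notin> \<real>\<^sub>\<le>\<^sub>0" "norm z < 1"
  shows "(mode \<alpha> \<beta> has_field_derivative mode_deriv \<alpha> \<beta> z / (z * (1 - z))) (at z)"
  unfolding mode_def[abs_def] mode_deriv_def hyp_deriv_def
  by (rule has_field_derivative_powr_powr_mult[OF z(1,2) has_field_derivative_hyp2F1[OF c z(3)]])

lemma has_field_derivative_mode_deriv:
  assumes z: "z \<notin> \<real>\<^sub>\<le>\<^sub>0" "1 - z \<notin> \<real>\<^sub>\<le>\<^sub>0" "norm z < 1"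
  shows "(mode_deriv \<alpha> \<beta> has_field_derivative mode_potential \<alpha> \<beta> z * mode \<alpha> \<beta> z / (z * (1 - z))) (at z)"
proof -
  define a where "a = \<alpha> + \<beta> + 1/2"
  define c where "c = 1 + 2 * \<alpha>"
  define F where "F = hyp2F1 a a c"
  define F1 where "F1 z = a * a / c * hyp2F1 (a + 1) (a + 1) (c + 1) z" for z
  define F2 where "F2 z = a * a / c * ((a + 1) * (a + 1) / (c + 1) * hyp2F1 (a + 2) (a + 2) (c + 2) z)" for z
  have c0: "c \<notin> \<int>\<^sub>\<le>\<^sub>0" using c by (simp add: c_def)
  then have c1: "c + 1 \<notin> \<int>\<^sub>\<le>\<^sub>0" using plus_one_in_nonpos_Ints_imp by blast
  have dF: "(F has_field_derivative F1 z) (at z)"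
    unfolding F_def F1_def by (rule has_field_derivative_hyp2F1[OF c0 z(3)])
  have dF1: "(F1 has_field_derivative F2 z) (at z)"
    unfolding F1_def[abs_def] F2_def
    using DERIV_cmult[OF has_field_derivative_hyp2F1[OF c1 z(3), of "a + 1" "a + 1" UNIV], of "a * a / c"]
    by (simp add: add.assoc)
  have eq: "z * (1 - z) * F2 z + (c - (a + a + 1) * z) * F1 z - a * a * F z = 0"
    unfolding F_def F1_def F2_def by (rule hypergeometric_equation[OF c0 z(3)])
  have "((\<lambda>z. (\<alpha> * (1 - z) - \<beta> * z) * F z + z * (1 - z) * F1 z) has_field_derivative
      (- \<alpha> - \<beta>) * F z + (\<alpha> * (1 - z) - \<beta> * z) * F1 z + (1 - 2 * z) * F1 z + z * (1 - z) * F2 z) (at z)"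
    by (auto intro!: derivative_eq_intros dF dF1 simp: algebra_simps)
  from has_field_derivative_powr_powr_mult[OF z(1,2) this, of \<alpha> \<beta>]
  have "(mode_deriv \<alpha> \<beta> has_field_derivative z powr \<alpha> * (1 - z) powr \<beta> *
      ((\<alpha> * (1 - z) - \<beta> * z) * ((\<alpha> * (1 - z) - \<beta> * z) * F z + z * (1 - z) * F1 z) +
       z * (1 - z) * ((- \<alpha> - \<beta>) * F z + (\<alpha> * (1 - z) - \<beta> * z) * F1 z + (1 - 2 * z) * F1 z + z * (1 - z) * F2 z)) /
      (z * (1 - z))) (at z)"
    unfolding mode_deriv_def[abs_def] hyp_deriv_def F1_def F_def a_def c_def .
  \<comment> \<open>The choice of a and c pays off here: what remains besides the potential is z (1
    - z) times the hypergeometric equation, which vanishes.\<close>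
  moreover have "(\<alpha> * (1 - z) - \<beta> * z) * ((\<alpha> * (1 - z) - \<beta> * z) * F z + z * (1 - z) * F1 z) +
       z * (1 - z) * ((- \<alpha> - \<beta>) * F z + (\<alpha> * (1 - z) - \<beta> * z) * F1 z + (1 - 2 * z) * F1 z + z * (1 - z) * F2 z)
      = mode_potential \<alpha> \<beta> z * F z + z * (1 - z) * (z * (1 - z) * F2 z + (c - (a + a + 1) * z) * F1 z - a * a * F z)"
    unfolding mode_potential_def a_def c_def by (simp add: field_simps power2_eq_square)
  ultimately show ?thesis
    unfolding eq mode_def by (simp add: F_def a_def c_def mult_ac)
qed

end

section \<open>The solutions as functions of v\<close>

definition wave :: "complex \<Rightarrow> complex \<Rightarrow> real \<Rightarrow> complex" where
  "wave \<alpha> \<beta> x = mode \<alpha> \<beta> (of_real (u_of x))"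

definition wave_potential :: "complex \<Rightarrow> complex \<Rightarrow> real \<Rightarrow> complex" where
  "wave_potential \<alpha> \<beta> x = mode_potential \<alpha> \<beta> (of_real (u_of x))"

lemma of_real_u_of:
  "complex_of_real (u_of x) \<notin> \<real>\<^sub>\<le>\<^sub>0" "1 - complex_of_real (u_of x) \<notin> \<real>\<^sub>\<le>\<^sub>0" "norm (complex_of_real (u_of x)) < 1"
  "complex_of_real (u_of x) \<noteq> 0" "1 - complex_of_real (u_of x) \<noteq> 0"
  using u_of_pos[of x] u_of_less_1[of x] by (auto simp: complex_nonpos_Reals_iff complex_eq_iff)

lemma has_vector_derivative_wave:
  assumes "1 + 2 * \<alpha> \<notin> \<int>\<^sub>\<le>\<^sub>0"
  shows "(wave \<alpha> \<beta> has_vector_derivative mode_deriv \<alpha> \<beta> (of_real (u_of x))) (at x)"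
    and "((\<lambda>x. mode_deriv \<alpha> \<beta> (of_real (u_of x))) has_vector_derivative wave_potential \<alpha> \<beta> x * wave \<alpha> \<beta> x) (at x)"
proof -
  define U where "U = complex_of_real (u_of x)"
  have "U * (1 - U) \<noteq> 0" using of_real_u_of(4,5)[of x] by (simp add: U_def)
  then have cancel: "U * (1 - U) * (D / (U * (1 - U))) = D" for D by simp
  note deriv = field_vector_diff_chain_at[OF has_vector_derivative_u_of[of x], folded U_def]
  show "(wave \<alpha> \<beta> has_vector_derivative mode_deriv \<alpha> \<beta> (of_real (u_of x))) (at x)"
    using deriv[OF has_field_derivative_mode[OF assms of_real_u_of(1-3)[of x], folded U_def, of \<beta>]]
    unfolding cancel by (simp add: wave_def[abs_def] U_def o_def)
  show "((\<lambda>x. mode_deriv \<alpha> \<beta> (of_real (u_of x))) has_vector_derivative wave_potential \<alpha> \<beta> x * wave \<alpha> \<beta> x) (at x)"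
    using deriv[OF has_field_derivative_mode_deriv[OF assms of_real_u_of(1-3)[of x], folded U_def, of \<beta>]]
    unfolding cancel by (simp add: wave_def wave_potential_def U_def o_def)
qed

lemma has_vector_derivative_wave_reflected:
  assumes "1 + 2 * \<beta> \<notin> \<int>\<^sub>\<le>\<^sub>0"
  shows "((\<lambda>x. wave \<beta> \<alpha> (- x)) has_vector_derivative - mode_deriv \<beta> \<alpha> (of_real (u_of (- x)))) (at x)"
    and "((\<lambda>x. - mode_deriv \<beta> \<alpha> (of_real (u_of (- x)))) has_vector_derivative
           wave_potential \<alpha> \<beta> x * wave \<beta> \<alpha> (- x)) (at x)"
proof -
  have m: "(uminus has_vector_derivative -1) (at x)" for x :: real
    by (auto intro!: derivative_eq_intros simp: has_real_derivative_iff_has_vector_derivative[symmetric])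
  show "((\<lambda>x. wave \<beta> \<alpha> (- x)) has_vector_derivative - mode_deriv \<beta> \<alpha> (of_real (u_of (- x)))) (at x)"
    using vector_diff_chain_at[OF m has_vector_derivative_wave(1)[OF assms]] by (simp add: o_def)
  have "wave_potential \<beta> \<alpha> (- x) = wave_potential \<alpha> \<beta> x"
    by (simp add: wave_potential_def mode_potential_def u_of_minus algebra_simps)
  then show "((\<lambda>x. - mode_deriv \<beta> \<alpha> (of_real (u_of (- x)))) has_vector_derivative
           wave_potential \<alpha> \<beta> x * wave \<beta> \<alpha> (- x)) (at x)"
    using has_vector_derivative_minus[OF vector_diff_chain_at[OF m has_vector_derivative_wave(2)[OF assms, where \<beta> = \<alpha>]], of x]
    by (simp add: o_def)
qed

lemma solves_wave: "1 + 2 * \<alpha> \<notin> \<int>\<^sub>\<le>\<^sub>0 \<Longrightarrow> solves (wave_potential \<alpha> \<beta>) (wave \<alpha> \<beta>)"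
  unfolding solves_def by (rule exI, rule allI, rule conjI; rule has_vector_derivative_wave; assumption)

lemma solves_wave_reflected: "1 + 2 * \<beta> \<notin> \<int>\<^sub>\<le>\<^sub>0 \<Longrightarrow> solves (wave_potential \<alpha> \<beta>) (\<lambda>x. wave \<beta> \<alpha> (- x))"
  unfolding solves_def by (rule exI, rule allI, rule conjI; rule has_vector_derivative_wave_reflected; assumption)

lemma norm_wave_potential_le: "norm (wave_potential \<alpha> \<beta> x) \<le> (norm \<alpha>)\<^sup>2 + (norm \<beta>)\<^sup>2 + 1"
proof -
  have u: "norm (1 - complex_of_real (u_of x)) \<le> 1" "norm (complex_of_real (u_of x)) \<le> 1" "\<bar>u_of x\<bar> \<le> 1"
    using u_of_pos[of x] u_of_less_1[of x] norm_of_real[of "1 - u_of x", where ?'a = complex] by simp_all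
  have "norm (wave_potential \<alpha> \<beta> x) \<le> (norm \<alpha>)\<^sup>2 * 1 + (norm \<beta>)\<^sup>2 * 1 + 1 * 1 / 4"
    unfolding wave_potential_def mode_potential_def
    by (intro norm_triangle_mono) (auto simp: norm_mult norm_power norm_divide intro!: mult_left_le mult_left_mono divide_right_mono mult_le_one u)
  then show ?thesis by simp
qed

text \<open>As x -> -infinity, u behaves like exp x in the strong sense ln u - x -> 0, so u^\<alpha>
  is equivalent to exp (\<alpha> x); the other two factors tend to 1.\<close>

lemma wave_asymp: "wave \<alpha> \<beta> \<sim>[at_bot] (\<lambda>x. exp (\<alpha> * of_real x))"
proof -
  have eq: "wave \<alpha> \<beta> x * exp (- (\<alpha> * of_real x)) =
      exp (\<alpha> * of_real (ln (u_of x) - x)) * exp (\<beta> * of_real (ln (1 - u_of x))) *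
      hyp2F1 (\<alpha> + \<beta> + 1/2) (\<alpha> + \<beta> + 1/2) (1 + 2 * \<alpha>) (of_real (u_of x))" for x
  proof -
    have "of_real t powr s = exp (s * of_real (ln t))" if "t > 0" for t and s :: complex
      using that by (simp add: powr_def Ln_of_real)
    from this[of "u_of x" \<alpha>] this[of "1 - u_of x" \<beta>]
    have "of_real (u_of x) powr \<alpha> = exp (\<alpha> * of_real (ln (u_of x)))"
      "(1 - of_real (u_of x)) powr \<beta> = exp (\<beta> * of_real (ln (1 - u_of x)))"
      using u_of_pos[of x] u_of_less_1[of x] by simp_all
    moreover have "exp (\<alpha> * of_real (ln (u_of x) - x)) = exp (\<alpha> * of_real (ln (u_of x))) * exp (- (\<alpha> * of_real x))"
      unfolding exp_add[symmetric] by (simp add: right_diff_distrib)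
    ultimately show ?thesis
      by (simp only: wave_def mode_def mult_ac)
  qed
  have u0: "(u_of \<longlongrightarrow> 0) at_bot"
    unfolding u_of_eq[abs_def] by real_asymp
  have "((\<lambda>x. ln (u_of x) - x) \<longlongrightarrow> 0) at_bot" "((\<lambda>x. ln (1 - u_of x)) \<longlongrightarrow> 0) at_bot"
    unfolding u_of_eq[abs_def] by real_asymp+
  moreover have "((\<lambda>x. hyp2F1 (\<alpha> + \<beta> + 1/2) (\<alpha> + \<beta> + 1/2) (1 + 2 * \<alpha>) (of_real (u_of x))) \<longlongrightarrow>
      hyp2F1 (\<alpha> + \<beta> + 1/2) (\<alpha> + \<beta> + 1/2) (1 + 2 * \<alpha>) 0) at_bot"
  proof (rule continuous_on_tendsto_compose[OF continuous_on_hyp2F1])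
    show "((\<lambda>x. complex_of_real (u_of x)) \<longlongrightarrow> 0) at_bot"
      using tendsto_of_real[OF u0, where ?'a = complex] by simp
  qed (use of_real_u_of(3) in auto)
  ultimately have "((\<lambda>x. wave \<alpha> \<beta> x * exp (- (\<alpha> * of_real x))) \<longlongrightarrow> exp (\<alpha> * of_real 0) * exp (\<beta> * of_real 0) * 1) at_bot"
    unfolding eq hyp2F1_0 by (intro tendsto_intros)
  then show ?thesis
    by (simp add: asymp_equiv_exp_iff)
qed

lemma wave_unique:
  assumes "Re \<alpha> \<ge> 0" "solves (wave_potential \<alpha> \<beta>) f" "f \<sim>[at_bot] (\<lambda>x. exp (\<alpha> * of_real x))"
  shows "f = wave \<alpha> \<beta>"
proof -
  have "1 + 2 * \<alpha> \<notin> \<int>\<^sub>\<le>\<^sub>0"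
    using assms(1) by (auto elim!: nonpos_Ints_cases simp: complex_eq_iff)
  from asymptotic_solution_unique[OF assms(2) solves_wave[OF this] norm_wave_potential_le assms(3) wave_asymp assms(1)]
  show ?thesis .
qed

section \<open>The Wronskian\<close>

text \<open>The Wronskian after the terms with \<alpha> (1 - z) - \<beta> z have cancelled. Each
  solution contributes z^\<alpha> (1 - z)^\<beta> and a derivative in v adds z (1 - z), hence the
  exponents 1 + 2 \<alpha> and 1 + 2 \<beta>. In this form both the limit z -> 1 and the dependence
  on \<beta> are visible.\<close>

definition wron :: "complex \<Rightarrow> complex \<Rightarrow> complex \<Rightarrow> complex" where
  "wron \<alpha> \<beta> z = - (z powr (1 + 2 * \<alpha>) * (1 - z) powr (1 + 2 * \<beta>)) *
     (hyp2F1 (\<alpha> + \<beta> + 1/2) (\<alpha> + \<beta> + 1/2) (1 + 2 * \<alpha>) z * hyp_deriv \<beta> \<alpha> (1 - z) +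
      hyp_deriv \<alpha> \<beta> z * hyp2F1 (\<alpha> + \<beta> + 1/2) (\<alpha> + \<beta> + 1/2) (1 + 2 * \<beta>) (1 - z))"

lemma mode_wronskian:
  assumes z: "z \<noteq> 0" "z \<noteq> 1"
  shows "mode \<alpha> \<beta> z * (- mode_deriv \<beta> \<alpha> (1 - z)) - mode_deriv \<alpha> \<beta> z * mode \<beta> \<alpha> (1 - z) = wron \<alpha> \<beta> z"
proof -
  have P: "z powr (1 + 2 * \<alpha>) = z * (z powr \<alpha> * z powr \<alpha>)"
    unfolding mult_2 powr_add using z by simp
  have R: "(1 - z) powr (1 + 2 * \<beta>) = (1 - z) * ((1 - z) powr \<beta> * (1 - z) powr \<beta>)"
    unfolding mult_2 powr_add using z by simp
  define A B where "A = z powr \<alpha>" and "B = (1 - z) powr \<beta>"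
  define F H where "F = hyp2F1 (\<alpha> + \<beta> + 1/2) (\<alpha> + \<beta> + 1/2) (1 + 2 * \<alpha>) z"
    and "H = hyp2F1 (\<alpha> + \<beta> + 1/2) (\<alpha> + \<beta> + 1/2) (1 + 2 * \<beta>) (1 - z)"
  show ?thesis
    unfolding mode_def mode_deriv_def wron_def P R add.commute[of \<beta> \<alpha>] A_def[symmetric] B_def[symmetric]
      F_def[symmetric] H_def[symmetric] diff_diff_eq2
    by (simp add: A_def[symmetric] B_def[symmetric]) (simp add: algebra_simps)
qed

lemma wronskian_at_wave:
  assumes "1 + 2 * \<alpha> \<notin> \<int>\<^sub>\<le>\<^sub>0" "1 + 2 * \<beta> \<notin> \<int>\<^sub>\<le>\<^sub>0"
  shows "wronskian_at (wave \<alpha> \<beta>) (\<lambda>x. wave \<beta> \<alpha> (- x)) x = wron \<alpha> \<beta> (of_real (u_of x))"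
  unfolding wronskian_at_def vector_derivative_at[OF has_vector_derivative_wave(1)[OF assms(1)]]
    vector_derivative_at[OF has_vector_derivative_wave_reflected(1)[OF assms(2)]]
  using mode_wronskian[of "of_real (u_of x)" \<alpha> \<beta>] of_real_u_of(4,5)[of x]
  by (simp add: wave_def u_of_minus)

lemma wron_constant:
  assumes c: "1 + 2 * \<alpha> \<notin> \<int>\<^sub>\<le>\<^sub>0" "1 + 2 * \<beta> \<notin> \<int>\<^sub>\<le>\<^sub>0" and t: "0 < t" "t < 1" and s: "0 < s" "s < 1"
  shows "wron \<alpha> \<beta> (of_real t) = wron \<alpha> \<beta> (of_real s)"
proof -
  have "wronskian_at (wave \<alpha> \<beta>) (\<lambda>x. wave \<beta> \<alpha> (- x)) x = wronskian_at (wave \<alpha> \<beta>) (\<lambda>x. wave \<beta> \<alpha> (- x)) y" for x y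
    unfolding wronskian_at_def vector_derivative_at[OF has_vector_derivative_wave(1)[OF c(1)]]
      vector_derivative_at[OF has_vector_derivative_wave_reflected(1)[OF c(2)]]
    by (rule wronskian_constant[OF has_vector_derivative_wave[OF c(1)] has_vector_derivative_wave_reflected[OF c(2)]])
  then show ?thesis
    unfolding wronskian_at_wave[OF c] using u_of_logit[OF t] u_of_logit[OF s] by metis
qed

text \<open>As t -> 1, the weight (1 - t)^(1 + 2 \<beta>) sends F to 0 and F' to a product of Gamma
  factors, while the functions of 1 - t tend to their values at 0. Only the term with F'
  survives.\<close>

lemma wron_eq_of_Re_pos:
  assumes c: "1 + 2 * \<alpha> \<notin> \<int>\<^sub>\<le>\<^sub>0" and re: "Re (1 + 2 * \<beta>) > 0" and t: "0 < t" "t < 1"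
  shows "wron \<alpha> \<beta> (of_real t) = - (Gamma (1 + 2 * \<alpha>) * Gamma (1 + 2 * \<beta>) * (rGamma (\<alpha> + \<beta> + 1/2))\<^sup>2)"
proof -
  define a where "a = \<alpha> + \<beta> + 1/2"
  have g: "1 + 2 * \<beta> \<notin> \<int>\<^sub>\<le>\<^sub>0"
    using re by (auto elim!: nonpos_Ints_cases simp: complex_eq_iff)
  \<comment> \<open>The weight in \<open>wron\<close> is exactly the singular exponent g of F' at
    1.\<close>
  have id: "1 + 2 * \<beta> = a + a + 1 - (1 + 2 * \<alpha>)" by (simp add: a_def)
  note lim = hyp2F1_limits_at_1[OF c re id]
  have one: "((\<lambda>t. complex_of_real t) \<longlongrightarrow> 1) (at_left 1)"
    using tendsto_of_real[OF tendsto_ident_at, where ?'a = complex, of 1 "{..<1}"] by simp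
  have zero: "((\<lambda>t. 1 - complex_of_real t) \<longlongrightarrow> 0) (at_left 1)"
    using tendsto_diff[OF tendsto_const one, of 1] by simp
  have ev: "\<forall>\<^sub>F t in at_left (1::real). 0 < t \<and> t < 1"
    using eventually_at_left_real[of 0 1] by simp
  have small: "((\<lambda>t. hyp2F1 x y d (1 - complex_of_real t)) \<longlongrightarrow> hyp2F1 x y d 0) (at_left 1)" for x y d
  proof (rule continuous_on_tendsto_compose[OF continuous_on_hyp2F1 zero])
    show "\<forall>\<^sub>F t in at_left 1. 1 - complex_of_real t \<in> ball 0 1"
      using ev
    proof eventually_elim
      case (elim t)
      then show ?case using norm_of_real[of "1 - t", where ?'a = complex] by simp
    qed
  qed simp
  have pw: "((\<lambda>t. complex_of_real t powr (1 + 2 * \<alpha>)) \<longlongrightarrow> 1 powr (1 + 2 * \<alpha>)) (at_left 1)"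
    by (intro tendsto_powr_complex one tendsto_const) auto
  have "((\<lambda>t. - (complex_of_real t powr (1 + 2 * \<alpha>)) *
       ((of_real (1 - t) powr (1 + 2 * \<beta>) * hyp2F1 a a (1 + 2 * \<alpha>) (of_real t)) *
          (a * a / (1 + 2 * \<beta>) * hyp2F1 (a + 1) (a + 1) (1 + 2 * \<beta> + 1) (1 - of_real t)) +
        (of_real (1 - t) powr (1 + 2 * \<beta>) * (a * a / (1 + 2 * \<alpha>) * hyp2F1 (a + 1) (a + 1) (1 + 2 * \<alpha> + 1) (of_real t))) *
          hyp2F1 a a (1 + 2 * \<beta>) (1 - of_real t)))
     \<longlongrightarrow> - (1 powr (1 + 2 * \<alpha>)) *
       (0 * (a * a / (1 + 2 * \<beta>) * hyp2F1 (a + 1) (a + 1) (1 + 2 * \<beta> + 1) 0) +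
        (Gamma (1 + 2 * \<alpha>) * Gamma (1 + 2 * \<beta>) * rGamma a * rGamma a) * hyp2F1 a a (1 + 2 * \<beta>) 0)) (at_left 1)"
    by (intro tendsto_mult tendsto_add tendsto_minus tendsto_const pw lim small)
  then have L: "((\<lambda>t. wron \<alpha> \<beta> (of_real t)) \<longlongrightarrow> - (Gamma (1 + 2 * \<alpha>) * Gamma (1 + 2 * \<beta>) * (rGamma a)\<^sup>2)) (at_left 1)"
    unfolding wron_def hyp_deriv_def add.commute[of \<beta> \<alpha>] a_def[symmetric]
    by (simp add: power2_eq_square algebra_simps)
  have "((\<lambda>t. wron \<alpha> \<beta> (of_real t)) \<longlongrightarrow> wron \<alpha> \<beta> (of_real t)) (at_left 1)"
  proof (rule tendsto_eventually)
    show "\<forall>\<^sub>F x in at_left 1. wron \<alpha> \<beta> (of_real x) = wron \<alpha> \<beta> (of_real t)"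
      using ev by eventually_elim (use wron_constant[OF c g _ _ t] in blast)
  qed
  with L show ?thesis
    unfolding a_def by (intro tendsto_unique[of "at_left (1::real)"]) auto
qed

text \<open>Identity theorem in \<beta>, with \<alpha> and t fixed. Using \<open>rGamma\<close> for
  the denominator keeps the right side holomorphic also at the zeros of the Wronskian.\<close>

lemma wron_eq:
  assumes c: "1 + 2 * \<alpha> \<notin> \<int>\<^sub>\<le>\<^sub>0" "1 + 2 * \<beta> \<notin> \<int>\<^sub>\<le>\<^sub>0" and t: "0 < t" "t < 1"
  shows "wron \<alpha> \<beta> (of_real t) = - (Gamma (1 + 2 * \<alpha>) * Gamma (1 + 2 * \<beta>) * (rGamma (\<alpha> + \<beta> + 1/2))\<^sup>2)"
proof -
  define S where "S = {\<beta> :: complex. 1 + 2 * \<beta> \<notin> \<int>\<^sub>\<le>\<^sub>0}"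
  define S0 where "S0 = {\<beta> :: complex. Re \<beta> > - 1/2}"
  \<comment> \<open>Two descriptions of S are needed: as the complement of a countable set it is
    connected, and as the complement of a closed preimage it is open.\<close>
  have S_eq: "S = UNIV - (\<lambda>x. (x - 1) / 2) ` \<int>\<^sub>\<le>\<^sub>0"
  proof -
    have "x \<in> (\<lambda>x. (x - 1) / 2) ` \<int>\<^sub>\<le>\<^sub>0 \<longleftrightarrow> 1 + 2 * x \<in> \<int>\<^sub>\<le>\<^sub>0" for x :: complex
    proof
      assume "x \<in> (\<lambda>x. (x - 1) / 2) ` \<int>\<^sub>\<le>\<^sub>0"
      then obtain y where y: "y \<in> \<int>\<^sub>\<le>\<^sub>0" "x = (y - 1) / 2" by auto
      have "1 + 2 * x = y" unfolding y(2) by (simp add: field_simps)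
      then show "1 + 2 * x \<in> \<int>\<^sub>\<le>\<^sub>0" using y(1) by simp
    qed (auto intro: image_eqI[of _ _ "1 + 2 * x"])
    then show ?thesis by (auto simp: S_def)
  qed
  have opS: "open S"
  proof -
    have "closed ((\<lambda>\<beta>::complex. 1 + 2 * \<beta>) -` \<int>\<^sub>\<le>\<^sub>0)"
      by (intro closed_vimage closed_nonpos_Ints continuous_intros)
    moreover have "S = - ((\<lambda>\<beta>::complex. 1 + 2 * \<beta>) -` \<int>\<^sub>\<le>\<^sub>0)"
      by (auto simp: S_def)
    ultimately show ?thesis by (simp add: open_closed)
  qed
  have "countable ((\<lambda>x::complex. (x - 1) / 2) ` \<int>\<^sub>\<le>\<^sub>0)"
  proof -
    have eq: "\<int>\<^sub>\<le>\<^sub>0 = (\<lambda>n. - of_nat n :: complex) ` UNIV"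
      by (auto elim!: nonpos_Ints_cases')
    have "countable (\<int>\<^sub>\<le>\<^sub>0 :: complex set)"
      unfolding eq by (rule countable_image) simp
    then show ?thesis by (rule countable_image)
  qed
  then have conS: "connected S"
    unfolding S_eq by (intro connected_open_diff_countable) (auto simp: convex_connected)
  have sub: "S0 \<subseteq> S"
    by (auto simp: S0_def S_def elim!: nonpos_Ints_cases simp: complex_eq_iff)
  have opS0: "open S0" unfolding S0_def by (rule open_halfspace_Re_gt)
  have "0 \<in> S0" by (simp add: S0_def)
  then have neS0: "S0 \<noteq> {}" by blast
  have one: "norm (complex_of_real t) < 1" "norm (1 - complex_of_real t) < 1"
    using t norm_of_real[of "1 - t", where ?'a = complex] by simp_all
  have c1: "1 + 2 * \<alpha> + 1 \<notin> \<int>\<^sub>\<le>\<^sub>0" using c plus_one_in_nonpos_Ints_imp by blast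
  have S1: "1 + 2 * x \<notin> \<int>\<^sub>\<le>\<^sub>0" if "x \<in> S" for x
    using that by (simp add: S_def)
  have S2: "1 + 2 * x + 1 \<notin> \<int>\<^sub>\<le>\<^sub>0" "1 + 2 * x \<noteq> 0" if "x \<in> S" for x
    using S1[OF that] plus_one_in_nonpos_Ints_imp by (blast, metis zero_in_nonpos_Ints)
  note hyp_hol = holomorphic_hyp2F1[OF opS _ _ _ _ one(1)] holomorphic_hyp2F1[OF opS _ _ _ _ one(2)]
  have "(\<lambda>\<beta>. hyp2F1 (\<alpha> + \<beta> + 1/2) (\<alpha> + \<beta> + 1/2) (1 + 2 * \<alpha>) (of_real t)) holomorphic_on S"
    by (rule hyp_hol(1)) (use c(1) in \<open>auto intro!: holomorphic_intros\<close>)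
  moreover have "(\<lambda>\<beta>. hyp2F1 (\<alpha> + \<beta> + 1/2) (\<alpha> + \<beta> + 1/2) (1 + 2 * \<beta>) (1 - of_real t)) holomorphic_on S"
    by (rule hyp_hol(2)) (use S1 in \<open>auto intro!: holomorphic_intros\<close>)
  moreover have "(\<lambda>\<beta>. hyp_deriv \<alpha> \<beta> (of_real t)) holomorphic_on S"
  proof -
    have "(\<lambda>\<beta>. hyp2F1 (\<alpha> + \<beta> + 1/2 + 1) (\<alpha> + \<beta> + 1/2 + 1) (1 + 2 * \<alpha> + 1) (of_real t)) holomorphic_on S"
      by (rule hyp_hol(1)) (use c1 in \<open>auto intro!: holomorphic_intros\<close>)
    then show ?thesis
      unfolding hyp_deriv_def divide_inverse by (intro holomorphic_on_mult holomorphic_on_add holomorphic_on_const holomorphic_on_ident)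
  qed
  moreover have "(\<lambda>\<beta>. hyp_deriv \<beta> \<alpha> (1 - of_real t)) holomorphic_on S"
  proof -
    have "(\<lambda>\<beta>. hyp2F1 (\<beta> + \<alpha> + 1/2 + 1) (\<beta> + \<alpha> + 1/2 + 1) (1 + 2 * \<beta> + 1) (1 - of_real t)) holomorphic_on S"
      by (rule hyp_hol(2)) (use S2(1) in \<open>auto intro!: holomorphic_intros\<close>)
    then show ?thesis
      unfolding hyp_deriv_def
      by (intro holomorphic_on_mult holomorphic_on_divide holomorphic_on_add holomorphic_on_const holomorphic_on_ident S2(2))
  qed
  ultimately have h1: "(\<lambda>\<beta>. wron \<alpha> \<beta> (of_real t)) holomorphic_on S"
    unfolding wron_def
    by (intro holomorphic_on_mult holomorphic_on_add holomorphic_on_minus holomorphic_on_powr_right holomorphic_on_const holomorphic_on_ident)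
  have h2: "(\<lambda>\<beta>. - (Gamma (1 + 2 * \<alpha>) * Gamma (1 + 2 * \<beta>) * (rGamma (\<alpha> + \<beta> + 1/2))\<^sup>2)) holomorphic_on S"
    by (intro holomorphic_intros) (auto simp: S_def)
  have h3: "wron \<alpha> \<beta> (of_real t) = - (Gamma (1 + 2 * \<alpha>) * Gamma (1 + 2 * \<beta>) * (rGamma (\<alpha> + \<beta> + 1/2))\<^sup>2)"
    if "\<beta> \<in> S0" for \<beta>
    using that by (intro wron_eq_of_Re_pos c t) (simp add: S0_def)
  have "\<beta> \<in> S" using c(2) by (simp add: S_def)
  from analytic_continuation_open[OF opS0 opS neS0 conS sub h1 h2, OF h3 this] show ?thesis .
qed

section \<open>Return to the frequency w and the square root s\<close>

lemma hyp_a_eq: "hyp_a w (1 + s) = s / 2 + - \<i> * w / 2 + 1/2"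
  by (simp add: hyp_a_def field_simps)

lemma psi_less_eq_wave: "psi_less w (1 + s) = wave (s / 2) (- \<i> * w / 2)"
  by (rule ext) (simp add: psi_less_def wave_def mode_def hyp_a_eq Let_def)

lemma psi_greater_eq_wave: "psi_greater w (1 + s) = (\<lambda>x. wave (- \<i> * w / 2) (s / 2) (- x))"
proof -
  have "1 - (1 + s) + hyp_a w (1 + s) + hyp_a w (1 + s) = 1 + 2 * (- \<i> * w / 2)"
    by (simp add: hyp_a_def field_simps)
  then show ?thesis
    unfolding psi_greater_def wave_def mode_def Let_def
    by (simp add: hyp_a_eq u_of_minus mult_ac add.commute[of "s / 2"])
qed

text \<open>The potential contains s only through its square, so both roots, that is both sheets,
  belong to the same equation.\<close>

lemma mode_solution_iff_solves:
  assumes "s\<^sup>2 = 1 + (of_real q)\<^sup>2 - w\<^sup>2"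
  shows "mode_solution q w f \<longleftrightarrow> solves (wave_potential (s / 2) (- \<i> * w / 2)) f"
proof -
  have q: "(complex_of_real q)\<^sup>2 = s\<^sup>2 + w\<^sup>2 - 1" using assms by simp
  have pot: "of_real (potential q x) - w\<^sup>2 / 4 = wave_potential (s / 2) (- \<i> * w / 2) x" for x
    unfolding potential_def wave_potential_def mode_potential_def
    by (simp add: q power_mult_distrib power_divide) (simp add: field_simps power2_eq_square)
  have eqn: "- y + of_real (potential q x) * f x = w\<^sup>2 / 4 * f x \<longleftrightarrow> y = wave_potential (s / 2) (- \<i> * w / 2) x * f x" for x y
  proof -
    have "- y + R = L \<longleftrightarrow> y = R - L" for R L :: complex
      by (auto simp: algebra_simps)
    then show ?thesis unfolding pot[symmetric] left_diff_distrib .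
  qed
  show ?thesis
    unfolding mode_solution_def solves_def eqn
  proof
    assume "\<exists>f1 f2. \<forall>x. (f has_vector_derivative f1 x) (at x) \<and> (f1 has_vector_derivative f2 x) (at x) \<and>
      f2 x = wave_potential (s / 2) (- \<i> * w / 2) x * f x"
    then obtain f1 f2 where *: "\<And>x. (f has_vector_derivative f1 x) (at x) \<and> (f1 has_vector_derivative f2 x) (at x) \<and>
      f2 x = wave_potential (s / 2) (- \<i> * w / 2) x * f x" by blast
    show "\<exists>f1. \<forall>x. (f has_vector_derivative f1 x) (at x) \<and>
        (f1 has_vector_derivative wave_potential (s / 2) (- \<i> * w / 2) x * f x) (at x)"
    proof (intro exI allI)
      show "(f has_vector_derivative f1 x) (at x) \<and>
          (f1 has_vector_derivative wave_potential (s / 2) (- \<i> * w / 2) x * f x) (at x)" for x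
        using *[of x] by metis
    qed
  next
    assume "\<exists>f1. \<forall>x. (f has_vector_derivative f1 x) (at x) \<and>
        (f1 has_vector_derivative wave_potential (s / 2) (- \<i> * w / 2) x * f x) (at x)"
    then obtain f1 where *: "\<And>x. (f has_vector_derivative f1 x) (at x) \<and>
        (f1 has_vector_derivative wave_potential (s / 2) (- \<i> * w / 2) x * f x) (at x)" by blast
    show "\<exists>f1 f2. \<forall>x. (f has_vector_derivative f1 x) (at x) \<and> (f1 has_vector_derivative f2 x) (at x) \<and>
      f2 x = wave_potential (s / 2) (- \<i> * w / 2) x * f x"
      using * by (intro exI[of _ f1] exI[of _ "\<lambda>x. wave_potential (s / 2) (- \<i> * w / 2) x * f x"]) blast
  qed
qed

lemma asymp_equiv_reflect:
  fixes f g :: "real \<Rightarrow> complex"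
  shows "(\<lambda>x. f (- x)) \<sim>[at_top] (\<lambda>x. g (- x)) \<longleftrightarrow> f \<sim>[at_bot] g"
  by (simp add: at_bot_mirror asymp_equiv_filtermap_iff)

text \<open>Turns a solution prescribed at the horizon into one prescribed at -infinity, where the
  uniqueness lemma is available.\<close>

lemma solves_reflect:
  assumes "solves (wave_potential \<alpha> \<beta>) f"
  shows "solves (wave_potential \<beta> \<alpha>) (\<lambda>x. f (- x))"
proof -
  obtain f1 where f1: "\<And>x. (f has_vector_derivative f1 x) (at x)"
      "\<And>x. (f1 has_vector_derivative wave_potential \<alpha> \<beta> x * f x) (at x)"
    using assms by (auto simp: solves_def)
  have m: "(uminus has_vector_derivative -1) (at x)" for x :: real
    by (auto intro!: derivative_eq_intros simp: has_real_derivative_iff_has_vector_derivative[symmetric])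
  have pot: "wave_potential \<beta> \<alpha> x = wave_potential \<alpha> \<beta> (- x)" for x
    by (simp add: wave_potential_def mode_potential_def u_of_minus algebra_simps)
  have "((\<lambda>x. f (- x)) has_vector_derivative - f1 (- x)) (at x)" for x
    using vector_diff_chain_at[OF m f1(1)] by (simp add: o_def)
  moreover have "((\<lambda>x. - f1 (- x)) has_vector_derivative wave_potential \<beta> \<alpha> x * f (- x)) (at x)" for x
    using has_vector_derivative_minus[OF vector_diff_chain_at[OF m f1(2)], of x] by (simp add: o_def pot)
  ultimately show ?thesis unfolding solves_def by (intro exI[of _ "\<lambda>x. - f1 (- x)"]) blast
qed

section \<open>The Green function\<close>

lemma hyp_a_sum: "1 - (1 + s) + hyp_a w (1 + s) + hyp_a w (1 + s) = 1 - \<i> * w"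
  by (simp add: hyp_a_def field_simps)

lemma wronskian_at_psi:
  assumes s: "s \<notin> \<int>\<^sub>\<le>\<^sub>0" and w: "1 - \<i> * w \<notin> \<int>\<^sub>\<le>\<^sub>0"
  shows "wronskian_at (psi_less w (1 + s)) (psi_greater w (1 + s)) x =
     - (Gamma (1 + s) * Gamma (1 - \<i> * w) * (rGamma (hyp_a w (1 + s)))\<^sup>2)"
proof -
  have p: "1 + 2 * (s / 2) = 1 + s" "1 + 2 * (- \<i> * w / 2) = 1 - \<i> * w" by simp_all
  have "1 + s \<notin> \<int>\<^sub>\<le>\<^sub>0"
    using s plus_one_in_nonpos_Ints_imp[of s] by (auto simp: add.commute)
  then have c: "1 + 2 * (s / 2) \<notin> \<int>\<^sub>\<le>\<^sub>0" "1 + 2 * (- \<i> * w / 2) \<notin> \<int>\<^sub>\<le>\<^sub>0"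
    unfolding p using w by auto
  show ?thesis
    unfolding psi_less_eq_wave psi_greater_eq_wave wronskian_at_wave[OF c] wron_eq[OF c u_of_pos u_of_less_1] p hyp_a_eq ..
qed

text \<open>The definite description in \<open>W_const\<close> denotes something because the
  Wronskian does not depend on v.\<close>

lemma W_const_eq:
  assumes "s \<notin> \<int>\<^sub>\<le>\<^sub>0" "1 - \<i> * w \<notin> \<int>\<^sub>\<le>\<^sub>0"
  shows "\<i> * W_const w (1 + s) = - (Gamma (1 + s) * Gamma (1 - \<i> * w) * (rGamma (hyp_a w (1 + s)))\<^sup>2)"
proof -
  define K where "K = - (Gamma (1 + s) * Gamma (1 - \<i> * w) * (rGamma (hyp_a w (1 + s)))\<^sup>2)"
  have "W_const w (1 + s) = - \<i> * K"
    unfolding W_const_def wronskian_at_psi[OF assms] K_def[symmetric]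
  proof (rule the_equality)
    fix W assume "\<forall>v::real. \<i> * W = K"
    then have "\<i> * W = K" by simp
    then show "W = - \<i> * K" by (metis complex_i_mult_minus minus_mult_left mult.assoc minus_minus)
  qed simp
  then show ?thesis by (simp add: K_def)
qed

text \<open>The recurrence of Gamma turns (1 - c) Gamma (c - 1) into - Gamma c. At s = 0 the factor
  1 - c would vanish against a pole.\<close>

lemma C01_eq:
  assumes "s \<notin> \<int>\<^sub>\<le>\<^sub>0"
  shows "(1 - (1 + s)) * C01 w (1 + s) = - (Gamma (1 + s) * Gamma (1 - \<i> * w) * (rGamma (hyp_a w (1 + s)))\<^sup>2)"
proof -
  have "Gamma (1 + s) = s * Gamma s"
    using Gamma_plus1[OF assms] by (simp add: add.commute)
  then show ?thesis
    unfolding C01_def Let_def hyp_a_sum rGamma_inverse_Gamma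
    by (simp add: power2_eq_square divide_inverse mult_ac)
qed

lemma greens_eq:
  assumes "s \<notin> \<int>\<^sub>\<le>\<^sub>0" "1 - \<i> * w \<notin> \<int>\<^sub>\<le>\<^sub>0"
  shows "greens w (1 + s) v v' =
    \<i> * (of_real (u_of (min v v') * u_of (max v v')) powr ((1 + s - 1) / 2) *
       of_real ((1 - u_of (min v v')) * (1 - u_of (max v v'))) powr (- \<i> * w / 2)) / ((1 - (1 + s)) * C01 w (1 + s)) *
     hyp2F1 (hyp_a w (1 + s)) (hyp_a w (1 + s)) (1 + s) (of_real (u_of (min v v'))) *
     hyp2F1 (hyp_a w (1 + s)) (hyp_a w (1 + s)) (1 - (1 + s) + hyp_a w (1 + s) + hyp_a w (1 + s)) (of_real (1 - u_of (max v v')))"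
proof -
  have K: "(1 - (1 + s)) * C01 w (1 + s) = \<i> * W_const w (1 + s)"
    unfolding C01_eq[OF assms(1)] W_const_eq[OF assms] ..
  have pw: "complex_of_real (x * y) powr z = of_real x powr z * of_real y powr z" if "0 < x" "0 < y" for x y z
    unfolding of_real_mult using that by (intro powr_times_real) auto
  have u: "0 < u_of x" "0 < 1 - u_of x" for x
    using u_of_pos[of x] u_of_less_1[of x] by auto
  \<comment> \<open>Origin of the factor i in the closed formula: the known quantity is i W, not W.
    Division by zero makes the identity valid for W = 0 too.\<close>
  have "A * B / W = \<i> * (A * B) / (\<i> * W)" for A B W :: complex by simp
  from this[of "psi_less w (1 + s) (min v v')" "psi_greater w (1 + s) (max v v')"]
  show ?thesis
    unfolding greens_def K pw[OF u(1) u(1)] pw[OF u(2) u(2)] psi_less_def psi_greater_def Let_def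
    by (simp only: divide_inverse mult_ac)
qed

text \<open>The radicand has imaginary part -2 Re w Im w. If it is real, then Re w = 0 and its value
  is 1 + q^2 + (Im w)^2 > 0. Thus the upper half-plane never meets the branch cut of
  \<open>csqrt\<close>, and a root with real part 0 would have a square on that cut.\<close>

lemma csqrt_upper_half_plane:
  assumes "Im w > 0"
  shows "1 + (complex_of_real q)\<^sup>2 - w\<^sup>2 \<notin> \<real>\<^sub>\<le>\<^sub>0" "Re (csqrt (1 + (complex_of_real q)\<^sup>2 - w\<^sup>2)) > 0"
proof -
  show nr: "1 + (complex_of_real q)\<^sup>2 - w\<^sup>2 \<notin> \<real>\<^sub>\<le>\<^sub>0"
  proof
    assume "1 + (complex_of_real q)\<^sup>2 - w\<^sup>2 \<in> \<real>\<^sub>\<le>\<^sub>0"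
    then have "Re (1 + (complex_of_real q)\<^sup>2 - w\<^sup>2) \<le> 0" "Im (1 + (complex_of_real q)\<^sup>2 - w\<^sup>2) = 0"
      by (simp_all add: complex_nonpos_Reals_iff)
    then have *: "1 + q\<^sup>2 - ((Re w)\<^sup>2 - (Im w)\<^sup>2) \<le> 0" "Re w * Im w = 0"
      by (auto simp: power2_eq_square)
    then have "Re w = 0" using assms by simp
    with * show False using zero_le_power2[of q] zero_le_power2[of "Im w"] by simp
  qed
  show "Re (csqrt (1 + (complex_of_real q)\<^sup>2 - w\<^sup>2)) > 0"
  proof (rule ccontr)
    assume "\<not> ?thesis"
    then have "Re (csqrt (1 + (complex_of_real q)\<^sup>2 - w\<^sup>2)) = 0"
      using csqrt_principal[of "1 + (complex_of_real q)\<^sup>2 - w\<^sup>2"] by auto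
    moreover define r where "r = csqrt (1 + (complex_of_real q)\<^sup>2 - w\<^sup>2)"
    moreover have "r\<^sup>2 = 1 + (complex_of_real q)\<^sup>2 - w\<^sup>2" by (simp add: r_def)
    ultimately have "1 + (complex_of_real q)\<^sup>2 - w\<^sup>2 \<in> \<real>\<^sub>\<le>\<^sub>0"
      by (metis nr complex_nonpos_Reals_iff Re_power2 Im_power2 diff_0 mult_zero_right mult_zero_left
          neg_le_0_iff_le power_zero_numeral zero_le_power2)
    with nr show False by simp
  qed
qed

lemma nonpos_Ints_Re: "Re z > 0 \<Longrightarrow> z \<notin> \<int>\<^sub>\<le>\<^sub>0"
  by (auto elim!: nonpos_Ints_cases)

lemma greens_holomorphic:
  "(\<lambda>w. greens w (c_phys q w) v v') holomorphic_on {w. Im w > 0}"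
proof -
  define S where "S = {w. Im w > 0}"
  have opS: "open S" unfolding S_def by (rule open_halfspace_Im_gt)
  define s where "s w = csqrt (1 + (complex_of_real q)\<^sup>2 - w\<^sup>2)" for w
  have s_re: "Re (s w) > 0" if "w \<in> S" for w
    using csqrt_upper_half_plane(2)[of w q] that by (simp add: s_def S_def)
  have s_hol: "s holomorphic_on S"
    unfolding s_def[abs_def] using csqrt_upper_half_plane(1)[of _ q]
    by (intro holomorphic_on_csqrt' holomorphic_intros) (auto simp: S_def)
  have a_hol: "(\<lambda>w. hyp_a w (1 + s w)) holomorphic_on S"
    unfolding hyp_a_def by (intro holomorphic_intros s_hol) auto
  have a_re: "Re (hyp_a w (1 + s w)) > 0" if "w \<in> S" for w
    using s_re[OF that] that by (simp add: hyp_a_def S_def)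
  have w_re: "Re (1 - \<i> * w) > 0" if "w \<in> S" for w
    using that by (simp add: S_def)
  have c_re: "Re (1 + s w) > 0" if "w \<in> S" for w
    using s_re[OF that] by simp
  define u1 u2 where "u1 = u_of (min v v')" and "u2 = u_of (max v v')"
  have u: "norm (complex_of_real u1) < 1" "norm (complex_of_real (1 - u2)) < 1"
    using u_of_pos[of "min v v'"] u_of_less_1[of "min v v'"] u_of_pos[of "max v v'"] u_of_less_1[of "max v v'"]
    by (simp_all add: u1_def u2_def abs_less_iff del: of_real_diff)
  \<comment> \<open>\<open>greens\<close> contains a definite description, which holomorphy rules
    cannot treat. The explicit formula g agrees with it on S.\<close>
  define g where "g w = \<i> * (of_real (u1 * u2) powr ((1 + s w - 1) / 2) * of_real ((1 - u1) * (1 - u2)) powr (- \<i> * w / 2)) /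
      - (Gamma (1 + s w) * Gamma (1 - \<i> * w) * (rGamma (hyp_a w (1 + s w)))\<^sup>2) *
     hyp2F1 (hyp_a w (1 + s w)) (hyp_a w (1 + s w)) (1 + s w) (of_real u1) *
     hyp2F1 (hyp_a w (1 + s w)) (hyp_a w (1 + s w)) (1 - \<i> * w) (of_real (1 - u2))" for w
  have F_hol: "(\<lambda>w. hyp2F1 (hyp_a w (1 + s w)) (hyp_a w (1 + s w)) (1 + s w) (of_real u1)) holomorphic_on S"
    by (rule holomorphic_hyp2F1[OF opS a_hol a_hol _ _ u(1)])
      (use nonpos_Ints_Re[OF c_re] in \<open>auto intro!: holomorphic_intros s_hol\<close>)
  have H_hol: "(\<lambda>w. hyp2F1 (hyp_a w (1 + s w)) (hyp_a w (1 + s w)) (1 - \<i> * w) (of_real (1 - u2))) holomorphic_on S"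
    by (rule holomorphic_hyp2F1[OF opS a_hol a_hol _ _ u(2)])
      (use nonpos_Ints_Re[OF w_re] in \<open>auto intro!: holomorphic_intros\<close>)
  have G_hol: "(\<lambda>w. Gamma (1 + s w)) holomorphic_on S" "(\<lambda>w. Gamma (1 - \<i> * w)) holomorphic_on S"
    "(\<lambda>w. rGamma (hyp_a w (1 + s w))) holomorphic_on S"
    using nonpos_Ints_Re[OF c_re] nonpos_Ints_Re[OF w_re]
    by (auto intro!: holomorphic_intros s_hol a_hol)
  have nz: "- (Gamma (1 + s w) * Gamma (1 - \<i> * w) * (rGamma (hyp_a w (1 + s w)))\<^sup>2) \<noteq> 0" if "w \<in> S" for w
    using nonpos_Ints_Re[OF c_re[OF that]] nonpos_Ints_Re[OF w_re[OF that]] nonpos_Ints_Re[OF a_re[OF that]]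
    by (simp add: Gamma_eq_zero_iff rGamma_eq_zero_iff)
  have "g holomorphic_on S"
    unfolding g_def[abs_def]
    by (intro holomorphic_on_mult holomorphic_on_divide holomorphic_on_minus holomorphic_on_power holomorphic_on_add
        holomorphic_on_diff holomorphic_on_const holomorphic_on_ident holomorphic_on_powr_right F_hol H_hol G_hol s_hol nz) auto
  moreover have "g w = greens w (c_phys q w) v v'" if "w \<in> S" for w
    unfolding c_phys_def s_def[symmetric] greens_eq[OF nonpos_Ints_Re[OF s_re[OF that]] nonpos_Ints_Re[OF w_re[OF that]]]
      C01_eq[OF nonpos_Ints_Re[OF s_re[OF that]]] hyp_a_sum g_def u1_def u2_def ..
  ultimately show ?thesis
    unfolding S_def[symmetric] by (rule holomorphic_transform)
qed

text \<open>The first part ranges over both roots s, hence over both sheets; the excluded parameters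
  are poles of Gamma factors. Nonvanishing of \<open>W_const\<close> stands next to holomorphy so
  that the quotient in \<open>greens\<close> is never a default value of division by zero.\<close>

theorem mainTheorem5:
  fixes q v v' :: real
  shows
    "(\<forall>w s :: complex.
        s\<^sup>2 = 1 + (of_real q)\<^sup>2 - w\<^sup>2 \<and> s \<notin> \<int>\<^sub>\<le>\<^sub>0 \<and> 1 - \<i> * w \<notin> \<int>\<^sub>\<le>\<^sub>0 \<longrightarrow>
        (let c = 1 + s; a = (c - \<i> * w) / 2; b = a;
             u1 = u_of (min v v'); u2 = u_of (max v v')
         in
           mode_solution q w (psi_less w c) \<and>
           psi_less w c \<sim>[at_bot] (\<lambda>x. exp (s * of_real x / 2)) \<and>
           mode_solution q w (psi_greater w c) \<and>
           psi_greater w c \<sim>[at_top] (\<lambda>x. exp (\<i> * w * of_real x / 2)) \<and>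
           (Re s \<ge> 0 \<longrightarrow>
             (\<forall>f. mode_solution q w f \<and> f \<sim>[at_bot] (\<lambda>x. exp (s * of_real x / 2))
                \<longrightarrow> f = psi_less w c)) \<and>
           (Im w \<ge> 0 \<longrightarrow>
             (\<forall>g. mode_solution q w g \<and> g \<sim>[at_top] (\<lambda>x. exp (\<i> * w * of_real x / 2))
                \<longrightarrow> g = psi_greater w c)) \<and>
           (\<forall>x. \<i> * W_const w c = wronskian_at (psi_less w c) (psi_greater w c) x) \<and>
           \<i> * W_const w c = (1 - c) * C01 w c \<and>
           (1 - c) * C01 w c = - (Gamma (1 - c + a + b) * Gamma c / (Gamma a * Gamma b)) \<and>
           greens w c v v' =
             \<i> * (of_real (u1 * u2) powr ((c - 1) / 2) *
                  of_real ((1 - u1) * (1 - u2)) powr (- \<i> * w / 2)) / ((1 - c) * C01 w c) *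
             hyp2F1 a b c (of_real u1) * hyp2F1 a b (1 - c + a + b) (of_real (1 - u2))))
     \<and> (\<forall>w. Im w > 0 \<longrightarrow> Re (csqrt (1 + (of_real q)\<^sup>2 - w\<^sup>2)) > 0 \<and> W_const w (c_phys q w) \<noteq> 0)
     \<and> (\<lambda>w. greens w (c_phys q w) v v') holomorphic_on {w. Im w > 0}"
proof (intro conjI allI impI)
  fix w s :: complex
  assume asm: "s\<^sup>2 = 1 + (of_real q)\<^sup>2 - w\<^sup>2 \<and> s \<notin> \<int>\<^sub>\<le>\<^sub>0 \<and> 1 - \<i> * w \<notin> \<int>\<^sub>\<le>\<^sub>0"
  then have s2: "s\<^sup>2 = 1 + (of_real q)\<^sup>2 - w\<^sup>2" and s: "s \<notin> \<int>\<^sub>\<le>\<^sub>0" and w: "1 - \<i> * w \<notin> \<int>\<^sub>\<le>\<^sub>0" by auto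
  define \<alpha> \<beta> where "\<alpha> = s / 2" and "\<beta> = - \<i> * w / 2"
  have c1: "1 + 2 * \<alpha> \<notin> \<int>\<^sub>\<le>\<^sub>0"
    using s plus_one_in_nonpos_Ints_imp[of s] by (auto simp: add.commute \<alpha>_def)
  have c2: "1 + 2 * \<beta> \<notin> \<int>\<^sub>\<le>\<^sub>0" using w by (simp add: \<beta>_def)
  note sol = mode_solution_iff_solves[OF s2, folded \<alpha>_def \<beta>_def]
  note psi = psi_less_eq_wave[of w s, folded \<alpha>_def \<beta>_def] psi_greater_eq_wave[of w s, folded \<alpha>_def \<beta>_def]
  have ea: "exp (s * of_real x / 2) = exp (\<alpha> * of_real x)" for x
    by (simp add: \<alpha>_def)
  \<comment> \<open>The condition at the horizon is the one at -infinity for the exponent \<beta>,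
    reflected.\<close>
  have eb: "exp (\<i> * w * of_real x / 2) = exp (\<beta> * of_real (- x))" for x
    by (simp add: \<beta>_def)
  have p1: "mode_solution q w (psi_less w (1 + s))"
    unfolding sol psi by (rule solves_wave[OF c1])
  have p2: "psi_less w (1 + s) \<sim>[at_bot] (\<lambda>x. exp (s * of_real x / 2))"
    unfolding psi ea by (rule wave_asymp)
  have p3: "mode_solution q w (psi_greater w (1 + s))"
    unfolding sol psi by (rule solves_wave_reflected[OF c2])
  have p4: "psi_greater w (1 + s) \<sim>[at_top] (\<lambda>x. exp (\<i> * w * of_real x / 2))"
    unfolding psi eb asymp_equiv_reflect[of "wave \<beta> \<alpha>" "\<lambda>x. exp (\<beta> * of_real x)"] by (rule wave_asymp)
  have p5: "f = psi_less w (1 + s)" if "Re s \<ge> 0" "mode_solution q w f" "f \<sim>[at_bot] (\<lambda>x. exp (s * of_real x / 2))" for f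
    unfolding psi using that unfolding sol ea by (intro wave_unique) (auto simp: \<alpha>_def)
  have p6: "g = psi_greater w (1 + s)"
    if "Im w \<ge> 0" "mode_solution q w g" "g \<sim>[at_top] (\<lambda>x. exp (\<i> * w * of_real x / 2))" for g
  proof -
    \<comment> \<open>Since Re \<beta> = Im w / 2, the assumption Im w \<ge> 0 is the sign condition
      of \<open>wave_unique\<close> for the reflected function.\<close>
    have "solves (wave_potential \<beta> \<alpha>) (\<lambda>x. g (- x))"
      using that(2) unfolding sol by (rule solves_reflect)
    moreover have "(\<lambda>x. g (- x)) \<sim>[at_bot] (\<lambda>x. exp (\<beta> * of_real x))"
      using that(3) asymp_equiv_reflect[of "\<lambda>x. g (- x)" "\<lambda>x. exp (\<beta> * of_real x)"] unfolding eb by simp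
    ultimately have "(\<lambda>x. g (- x)) = wave \<beta> \<alpha>"
      using that(1) by (intro wave_unique) (auto simp: \<beta>_def)
    then have "g (- (- x)) = wave \<beta> \<alpha> (- x)" for x by metis
    then show ?thesis unfolding psi by auto
  qed
  have p7: "\<i> * W_const w (1 + s) = wronskian_at (psi_less w (1 + s)) (psi_greater w (1 + s)) x" for x
    unfolding W_const_eq[OF s w] wronskian_at_psi[OF s w] ..
  have p8: "\<i> * W_const w (1 + s) = (1 - (1 + s)) * C01 w (1 + s)"
    unfolding W_const_eq[OF s w] C01_eq[OF s] ..
  have p9: "(1 - (1 + s)) * C01 w (1 + s) = - (Gamma (1 - (1 + s) + hyp_a w (1 + s) + hyp_a w (1 + s)) * Gamma (1 + s) /
      (Gamma (hyp_a w (1 + s)) * Gamma (hyp_a w (1 + s))))"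
    unfolding C01_eq[OF s] hyp_a_sum rGamma_inverse_Gamma
    by (simp add: power2_eq_square divide_inverse mult_ac)
  note all = p1 p2 p3 p4 p5 p6 p7 p8 p9 greens_eq[OF s w, of v v']
  show "let c = 1 + s; a = (c - \<i> * w) / 2; b = a;
             u1 = u_of (min v v'); u2 = u_of (max v v')
         in
           mode_solution q w (psi_less w c) \<and>
           psi_less w c \<sim>[at_bot] (\<lambda>x. exp (s * of_real x / 2)) \<and>
           mode_solution q w (psi_greater w c) \<and>
           psi_greater w c \<sim>[at_top] (\<lambda>x. exp (\<i> * w * of_real x / 2)) \<and>
           (Re s \<ge> 0 \<longrightarrow>
             (\<forall>f. mode_solution q w f \<and> f \<sim>[at_bot] (\<lambda>x. exp (s * of_real x / 2))
                \<longrightarrow> f = psi_less w c)) \<and>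
           (Im w \<ge> 0 \<longrightarrow>
             (\<forall>g. mode_solution q w g \<and> g \<sim>[at_top] (\<lambda>x. exp (\<i> * w * of_real x / 2))
                \<longrightarrow> g = psi_greater w c)) \<and>
           (\<forall>x. \<i> * W_const w c = wronskian_at (psi_less w c) (psi_greater w c) x) \<and>
           \<i> * W_const w c = (1 - c) * C01 w c \<and>
           (1 - c) * C01 w c = - (Gamma (1 - c + a + b) * Gamma c / (Gamma a * Gamma b)) \<and>
           greens w c v v' =
             \<i> * (of_real (u1 * u2) powr ((c - 1) / 2) *
                  of_real ((1 - u1) * (1 - u2)) powr (- \<i> * w / 2)) / ((1 - c) * C01 w c) *
             hyp2F1 a b c (of_real u1) * hyp2F1 a b (1 - c + a + b) (of_real (1 - u2))"
    unfolding Let_def hyp_a_def[symmetric] by (intro conjI impI allI; (elim conjE)?; rule all; assumption?)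
next
  fix w :: complex assume w: "Im w > 0"
  define s where "s = csqrt (1 + (complex_of_real q)\<^sup>2 - w\<^sup>2)"
  show s_re: "Re (csqrt (1 + (of_real q)\<^sup>2 - w\<^sup>2)) > 0"
    by (rule csqrt_upper_half_plane(2)[OF w])
  then have s_pos: "Re s > 0" by (simp only: s_def)
  then have s: "s \<notin> \<int>\<^sub>\<le>\<^sub>0" "1 + s \<notin> \<int>\<^sub>\<le>\<^sub>0"
    by (auto intro!: nonpos_Ints_Re)
  have w': "1 - \<i> * w \<notin> \<int>\<^sub>\<le>\<^sub>0" using w by (intro nonpos_Ints_Re) simp
  have a: "hyp_a w (1 + s) \<notin> \<int>\<^sub>\<le>\<^sub>0"
    using w s_pos by (intro nonpos_Ints_Re) (simp add: hyp_a_def)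
  have "\<i> * W_const w (1 + s) \<noteq> 0"
    unfolding W_const_eq[OF s(1) w'] using s w' a by (simp add: Gamma_eq_zero_iff rGamma_eq_zero_iff)
  then show "W_const w (c_phys q w) \<noteq> 0" by (simp add: c_phys_def s_def)
next
  show "(\<lambda>w. greens w (c_phys q w) v v') holomorphic_on {w. Im w > 0}"
    by (rule greens_holomorphic)
qed

end
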